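(* Let $\mathcal X,\mathcal Y$ be compact metrizable spaces and let $c:\mathcal X\times\mathcal M(\mathcal Y)\to\mathbb R$ be a cost function satisfying: (A) there exist continuous functions $a_k:\mathcal X\to\mathbb R$ and $b_k:\mathcal X\times\mathcal Y\to\mathbb R$, $k\ge 0$, such that $c(x,m)=\sup_{k\ge 0}\left\{\int b_k(x,y)\,m(dy)+a_k(x)\right\}$ for all $x\in\mathcal X$, $m\in\mathcal M(\mathcal Y)$; (B) $\frac{c(x,\lambda m)}{\lambda}\to+\infty$ as $\lambda\to+\infty$, for all $x\in\mathcal X$ and all $m\in\mathcal M(\mathcal Y)\setminus\{0\}$. If $\mu\in\mathcal P(\mathcal X)$ and $\nu\in\mathcal P(\mathcal Y)$ are such that $\mathcal I_c(\mu,\nu)<+\infty$, then any weak solution of the transport problem defining $\mathcal I_c(\mu,\nu)$ is a strong solution.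
   Context: $\mathcal P(E)$ denotes the Borel probability measures on $E$; $\mathcal M(\mathcal Y)$ denotes the finite nonnegative Borel measures on $\mathcal Y$, with the weak topology. $\Pi(\ll\mu,\nu)$ is the set of Borel probability measures $\pi$ on $\mathcal X\times\mathcal Y$ whose first marginal $\pi_1$ is absolutely continuous with respect to $\mu$ and whose second marginal is $\nu$. For such $\pi$, disintegrated as $\pi(dxdy)=\pi_1(dx)\pi^x(dy)$, set $$I_c^\mu[\pi]=\int c\left(x,\frac{d\pi_1}{d\mu}(x)\,\pi^x\right)\mu(dx).$$ The transport problem is $\mathcal I_c(\mu,\nu)=\inf_{\pi\in\Pi(\ll\mu,\nu)}I_c^\mu[\pi]$. (Equivalently, $\mathcal I_c(\mu,\nu)=\inf_q\int c(x,q^x)\,\mu(dx)$ over nonnegative kernels $q=(q^x)_{x\in\mathcal X}$, $q^x\in\mathcal M(\mathcal Y)$, with $\int q^x(dy)\mu(dx)=\nu(dy)$, via $\pi(dxdy)=\mu(dx)q^x(dy)$.) A strong solution is a $\bar\pi\in\Pi(\ll\mu,\nu)$ with $I_c^\mu[\bar\pi]=\mathcal I_c(\mu,\nu)$. A weak solution is a $\bar\pi\in\mathcal P(\mathcal X\times\mathcal Y)$ for which there is a sequence $\pi_n\in\Pi(\ll\mu,\nu)$ with $\pi_n\to\bar\pi$ weakly and $I_c^\mu[\pi_n]\to\mathcal I_c(\mu,\nu)$. *)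

theory Defs
  imports "HOL-Probability.Probability"
begin

definition borel_probs :: "'e::topological_space measure set" where
  "borel_probs = {M. prob_space M \<and> sets M = sets borel}"

definition borel_finite_measures :: "'e::topological_space measure set" where
  "borel_finite_measures = {M. finite_measure M \<and> sets M = sets borel}"

definition weakly_converges ::
    "(nat \<Rightarrow> 'e::topological_space measure) \<Rightarrow> 'e measure \<Rightarrow> bool" where
  "weakly_converges P Q \<longleftrightarrow>
     (\<forall>f :: 'e \<Rightarrow> real. continuous_on UNIV f \<longrightarrow> bounded (range f) \<longrightarrow>
        (\<lambda>n. integral\<^sup>L (P n) f) \<longlonglongrightarrow> integral\<^sup>L Q f)"

definition marginal1 ::
    "('a::topological_space \<times> 'b::topological_space) measure \<Rightarrow> 'a measure" where
  "marginal1 \<pi> = distr \<pi> borel fst"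

definition marginal2 ::
    "('a::topological_space \<times> 'b::topological_space) measure \<Rightarrow> 'b measure" where
  "marginal2 \<pi> = distr \<pi> borel snd"

definition transport_plans :: "'a::topological_space measure \<Rightarrow> 'b::topological_space measure
    \<Rightarrow> ('a \<times> 'b) measure set" where
  "transport_plans \<mu> \<nu> =
     {\<pi> \<in> borel_probs. absolutely_continuous \<mu> (marginal1 \<pi>) \<and> marginal2 \<pi> = \<nu>}"

definition is_disintegration :: "('a::topological_space \<times> 'b::topological_space) measure
    \<Rightarrow> ('a \<Rightarrow> 'b measure) \<Rightarrow> bool" where
  "is_disintegration \<pi> K \<longleftrightarrow>
     K \<in> measurable borel (prob_algebra borel) \<and>
     (\<forall>A\<in>sets borel. \<forall>B\<in>sets borel.
        emeasure \<pi> (A \<times> B) = (\<integral>\<^sup>+x\<in>A. emeasure (K x) B \<partial>marginal1 \<pi>))"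

text \<open>On compact metrizable spaces a disintegration exists and is unique up to a null set of
  the first marginal, so the choice made here does not affect integrals against that marginal.\<close>

definition disintegration :: "('a::topological_space \<times> 'b::topological_space) measure
    \<Rightarrow> ('a \<Rightarrow> 'b measure)" where
  "disintegration \<pi> = (SOME K. is_disintegration \<pi> K)"

text \<open>Integral with values in the extended reals. Costs that are suprema as in
  \<open>affine_sup_cost\<close> below have an integrable negative part along transport plans, so the
  indeterminate form \<open>\<infinity> - \<infinity>\<close> does not arise.\<close>

definition ext_integral :: "'a measure \<Rightarrow> ('a \<Rightarrow> real) \<Rightarrow> ereal" where
  "ext_integral M f =
     enn2ereal (\<integral>\<^sup>+x. ennreal (f x) \<partial>M) - enn2ereal (\<integral>\<^sup>+x. ennreal (- f x) \<partial>M)"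

text \<open>Only the values of \<open>c x\<close> on \<open>borel_finite_measures\<close> matter: the density \<open>RN_deriv\<close> is finite
  almost everywhere, and where it vanishes the argument of \<open>c x\<close> is the zero measure
  irrespective of the kernel.\<close>

definition plan_cost :: "('a::topological_space \<Rightarrow> 'b::topological_space measure \<Rightarrow> real)
    \<Rightarrow> 'a measure \<Rightarrow> ('a \<times> 'b) measure \<Rightarrow> ereal" where
  "plan_cost c \<mu> \<pi> =
     ext_integral \<mu> (\<lambda>x. c x (scale_measure (RN_deriv \<mu> (marginal1 \<pi>) x) (disintegration \<pi> x)))"

definition transport_value :: "('a::topological_space \<Rightarrow> 'b::topological_space measure \<Rightarrow> real)
    \<Rightarrow> 'a measure \<Rightarrow> 'b measure \<Rightarrow> ereal" where
  "transport_value c \<mu> \<nu> = (INF \<pi>\<in>transport_plans \<mu> \<nu>. plan_cost c \<mu> \<pi>)"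

definition strong_solution :: "('a::topological_space \<Rightarrow> 'b::topological_space measure \<Rightarrow> real)
    \<Rightarrow> 'a measure \<Rightarrow> 'b measure \<Rightarrow> ('a \<times> 'b) measure \<Rightarrow> bool" where
  "strong_solution c \<mu> \<nu> \<pi> \<longleftrightarrow>
     \<pi> \<in> transport_plans \<mu> \<nu> \<and> plan_cost c \<mu> \<pi> = transport_value c \<mu> \<nu>"

definition weak_solution :: "('a::topological_space \<Rightarrow> 'b::topological_space measure \<Rightarrow> real)
    \<Rightarrow> 'a measure \<Rightarrow> 'b measure \<Rightarrow> ('a \<times> 'b) measure \<Rightarrow> bool" where
  "weak_solution c \<mu> \<nu> \<pi> \<longleftrightarrow>
     \<pi> \<in> borel_probs \<and>
     (\<exists>P. (\<forall>n. P n \<in> transport_plans \<mu> \<nu>) \<and> weakly_converges P \<pi> \<and>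
          (\<lambda>n. plan_cost c \<mu> (P n)) \<longlonglongrightarrow> transport_value c \<mu> \<nu>)"

text \<open>The supremum is taken in the extended reals, where it always exists; equality with the
  real number \<open>c x m\<close> includes its finiteness.\<close>

definition affine_sup_cost ::
    "('a::topological_space \<Rightarrow> 'b::topological_space measure \<Rightarrow> real) \<Rightarrow> bool" where
  "affine_sup_cost c \<longleftrightarrow>
     (\<exists>(a :: nat \<Rightarrow> 'a \<Rightarrow> real) (b :: nat \<Rightarrow> 'a \<times> 'b \<Rightarrow> real).
        (\<forall>k. continuous_on UNIV (a k)) \<and> (\<forall>k. continuous_on UNIV (b k)) \<and>
        (\<forall>x. \<forall>m\<in>borel_finite_measures.
           ereal (c x m) = (SUP k. ereal ((\<integral>y. b k (x, y) \<partial>m) + a k x))))"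

definition superlinear_cost ::
    "('a \<Rightarrow> 'b::topological_space measure \<Rightarrow> real) \<Rightarrow> bool" where
  "superlinear_cost c \<longleftrightarrow>
     (\<forall>x. \<forall>m \<in> borel_finite_measures - {null_measure borel}.
        filterlim (\<lambda>l::real. c x (scale_measure (ennreal l) m) / l) at_top at_top)"

end

theory Submission
  imports Defs
begin

text \<open>
  Why the theorem holds. Call a pair of continuous functions \<open>(b, a)\<close> an affine minorant of the cost
  if \<open>\<integral> b (x, y) m(dy) + a x \<le> c x m\<close> for all \<open>x\<close> and \<open>m\<close>. For such a pair
  \<open>\<integral> b d\<pi> + \<integral> a d\<mu>\<close> is at most the cost of any plan \<open>\<pi>\<close>, and it depends on \<open>\<pi>\<close> only through the
  integral of a continuous function, so it passes to weak limits. Hence a weak solution \<open>\<pi>\<close>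
  satisfies \<open>\<integral> b d\<pi> + \<integral> a d\<mu> \<le> J\<close> for every affine minorant, \<open>J\<close> being the transport value; at this
  point \<open>\<pi>\<close> is not yet known to be a transport plan.

  Affine minorants are stable under blending with continuous weights \<open>\<theta> x \<in> [0, 1]\<close>, because
  for fixed \<open>x\<close> a blend is a convex combination. Continuous weights approximate indicators of Borel
  sets in the mean, for \<open>\<mu>\<close> and for the first marginal \<open>\<pi>\<^sub>1\<close> simultaneously; so the bound survives when
  the index \<open>k\<close> of the family \<open>(b\<^sub>k, a\<^sub>k)\<close> is chosen as a Borel function \<open>\<kappa>\<close> of \<open>x\<close> with finitely many
  values (\<open>selection_integral_le\<close>). In terms of the disintegration, with
  \<open>\<beta>\<^sub>k x = \<integral> b\<^sub>k (x, y) \<pi>\<^sup>x(dy)\<close>, this reads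
  \<open>\<integral> \<beta>\<^bsub>\<kappa> x\<^esub> x \<pi>\<^sub>1(dx) + \<integral> a\<^bsub>\<kappa> x\<^esub> x \<mu>(dx) \<le> J\<close>. Two choices of \<open>\<kappa>\<close> give the theorem.

  \<^item> Superlinearity along the rays through \<open>\<pi>\<^sup>x\<close> forces \<open>sup\<^sub>k \<beta>\<^sub>k x = \<infinity>\<close> for every \<open>x\<close>
    (\<open>cond_means_unbounded\<close>). Maximising \<open>\<beta>\<^sub>k\<close> over \<open>k \<le> n\<close> on a \<open>\<mu>\<close>-null set leaves the second
    integral unchanged and makes the first one grow without bound unless the set is \<open>\<pi>\<^sub>1\<close>-null. So
    \<open>\<pi>\<^sub>1\<close> is absolutely continuous (\<open>absolutely_continuous_marginal\<close>).

  \<^item> With a density \<open>\<rho>\<close> of \<open>\<pi>\<^sub>1\<close>, maximising \<open>\<rho> x * \<beta>\<^sub>k x + a\<^sub>k x\<close> over \<open>k \<le> n\<close> gives functions that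
    increase to \<open>c x (\<rho> x \<pi>\<^sup>x)\<close>. By monotone convergence the cost of \<open>\<pi>\<close> is at most \<open>J\<close>
    (\<open>plan_cost_le\<close>).

  The second marginal is preserved by weak convergence, so \<open>\<pi>\<close> is a transport plan and is optimal.

  The argument needs disintegrations on compact metric spaces, which are built here as follows. A
  compact metric space is a Borel retract of the real line: there are Borel maps \<open>h\<close> into
  \<open>[0, 1)\<close> and \<open>g\<close> back with \<open>g (h y) = y\<close>. A conditional law of \<open>h y\<close> given \<open>x\<close> comes from
  Radon-Nikodym derivatives at rational thresholds, and its image under \<open>g\<close> is the kernel.
\<close>

section \<open>Borel structure of compact metric spaces\<close>
lemma compact_metric_dense_sequence:
  assumes "compact (UNIV :: 'a::metric_space set)"
  obtains d :: "nat \<Rightarrow> 'a::metric_space" where "\<And>y e. e > 0 \<Longrightarrow> \<exists>i. dist y (d i) < e"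
proof -
  have "\<exists>k::'a set. finite k \<and> UNIV \<subseteq> (\<Union>x\<in>k. ball x (1 / Suc n))" for n
    using assms seq_compact_imp_totally_bounded[of "UNIV :: 'a set"]
    by (metis compact_imp_seq_compact divide_pos_pos of_nat_0_less_iff zero_less_Suc zero_less_one)
  then obtain k :: "nat \<Rightarrow> 'a set"
    where k: "\<And>n. finite (k n)" "\<And>n. UNIV \<subseteq> (\<Union>x\<in>k n. ball x (1 / Suc n))"
    by metis
  have "k 0 \<noteq> {}" using k(2)[of 0] by auto
  then have ne: "(\<Union>n. k n) \<noteq> {}" by auto
  have "countable (\<Union>n. k n)" using k(1) by (simp add: countable_finite)
  then have r: "range (from_nat_into (\<Union>n. k n)) = (\<Union>n. k n)"
    using ne by (simp add: range_from_nat_into)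
  show ?thesis
  proof (rule that)
    fix y :: 'a and e :: real assume "e > 0"
    then obtain n where n: "1 / Suc n < e" by (metis inverse_eq_divide reals_Archimedean)
    have "y \<in> (\<Union>x\<in>k n. ball x (1 / Suc n))" using k(2)[of n] by blast
    then obtain x where "x \<in> k n" "dist x y < 1 / Suc n" by (metis UN_E mem_ball)
    moreover then obtain i where "x = from_nat_into (\<Union>n. k n) i" using r by (metis UN_I UNIV_I imageE)
    ultimately show "\<exists>i. dist y (from_nat_into (\<Union>n. k n) i) < e"
      using n by (auto simp: dist_commute intro!: exI[of _ i])
  qed
qed

text \<open>Compactness provides the countable base that the class \<open>second_countable_topology\<close> would
  give: every open set is a countable union of products of balls around points of dense sequences.\<close>
lemma sets_borel_prod_compact:
  assumes "compact (UNIV :: 'a::metric_space set)" "compact (UNIV :: 'b::metric_space set)"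
  shows "sets (borel \<Otimes>\<^sub>M borel) = sets (borel :: ('a \<times> 'b) measure)"
proof
  have "fst \<in> borel \<rightarrow>\<^sub>M (borel :: 'a measure)" "snd \<in> borel \<rightarrow>\<^sub>M (borel :: 'b measure)"
    by (auto intro!: borel_measurable_continuous_onI continuous_intros)
  then have "(\<lambda>z. (fst z, snd z)) \<in> (borel :: ('a \<times> 'b) measure) \<rightarrow>\<^sub>M borel \<Otimes>\<^sub>M borel"
    by measurable
  then have id: "(\<lambda>z. z) \<in> (borel :: ('a \<times> 'b) measure) \<rightarrow>\<^sub>M borel \<Otimes>\<^sub>M borel" by simp
  show "sets (borel \<Otimes>\<^sub>M borel) \<subseteq> sets (borel :: ('a \<times> 'b) measure)"
    using measurable_sets[OF id] by (auto simp: space_pair_measure)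
next
  obtain d :: "nat \<Rightarrow> 'a" where d: "\<And>y e. e > 0 \<Longrightarrow> \<exists>i. dist y (d i) < e"
    using compact_metric_dense_sequence[OF assms(1)] by blast
  obtain d' :: "nat \<Rightarrow> 'b" where d': "\<And>y e. e > 0 \<Longrightarrow> \<exists>i. dist y (d' i) < e"
    using compact_metric_dense_sequence[OF assms(2)] by blast
  have "U \<in> sets (borel \<Otimes>\<^sub>M borel)" if U: "open U" for U :: "('a \<times> 'b) set"
  proof -
    define R where "R = (\<lambda>(i, j, n). ball (d i) (1 / Suc n) \<times> ball (d' j) (1 / Suc n))"
    have "U = (\<Union>t\<in>{t. R t \<subseteq> U}. R t)"
    proof (intro equalityI subsetI)
      fix z assume "z \<in> U"
      then obtain r where r: "r > 0" "ball z r \<subseteq> U" using U by (meson openE)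
      obtain n where n: "1 / Suc n < r / 4"
        using r(1) by (metis inverse_eq_divide reals_Archimedean divide_pos_pos zero_less_numeral)
      have pos: "0 < 1 / real (Suc n)" by simp
      obtain i j where ij: "dist (fst z) (d i) < 1 / Suc n" "dist (snd z) (d' j) < 1 / Suc n"
        using d[OF pos] d'[OF pos] by blast
      have "R (i, j, n) \<subseteq> ball z r"
      proof
        fix w assume w: "w \<in> R (i, j, n)"
        have "dist z w \<le> dist (fst z) (fst w) + dist (snd z) (snd w)"
          by (simp add: dist_prod_def sqrt_sum_squares_le_sum)
        also have "\<dots> \<le> (dist (fst z) (d i) + dist (d i) (fst w)) + (dist (snd z) (d' j) + dist (d' j) (snd w))"
          by (intro add_mono dist_triangle)
        also have "\<dots> < r" using w ij n by (auto simp: R_def mem_Times_iff)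
        finally show "w \<in> ball z r" by simp
      qed
      moreover have "z \<in> R (i, j, n)" using ij by (auto simp: R_def mem_Times_iff dist_commute)
      ultimately show "z \<in> (\<Union>t\<in>{t. R t \<subseteq> U}. R t)" using r(2) by blast
    qed auto
    also have "\<dots> \<in> sets (borel \<Otimes>\<^sub>M borel)"
      by (intro sets.countable_UN') (auto simp: R_def)
    finally show ?thesis .
  qed
  then have "sigma_sets (space (borel \<Otimes>\<^sub>M borel)) {U :: ('a \<times> 'b) set. open U} \<subseteq> sets (borel \<Otimes>\<^sub>M borel)"
    by (intro sets.sigma_sets_subset) auto
  then show "sets (borel :: ('a \<times> 'b) measure) \<subseteq> sets (borel \<Otimes>\<^sub>M borel)"
    unfolding sets_borel[where 'a="'a \<times> 'b"] by (simp only: space_pair_measure space_borel UNIV_Times_UNIV)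
qed

lemma sets_borel_closed: "sets (borel :: 'a::topological_space measure) = sigma_sets UNIV (Collect closed)"
  by (subst borel_eq_closed, rule sets_measure_of) simp

text \<open>Borel sets are reached from closed ones by a Dynkin argument. For a closed set the functions
  \<open>max 0 (1 - n * infdist x C)\<close> decrease to the indicator. A finite family of measures is treated at
  once because the minorants must later be close for \<open>\<mu>\<close> and for the first marginal of a plan with the
  same weight function.\<close>
lemma continuous_approx_indicator:
  fixes B :: "'a::metric_space set" and \<M> :: "'a measure set"
  assumes fin: "finite \<M>" and M: "\<M> \<subseteq> borel_finite_measures"
    and B: "B \<in> sets borel" and e: "e > 0"
  obtains \<theta> :: "'a \<Rightarrow> real" where "continuous_on UNIV \<theta>" "\<And>x. 0 \<le> \<theta> x \<and> \<theta> x \<le> 1"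
    "\<And>L. L \<in> \<M> \<Longrightarrow> (\<integral>x. \<bar>\<theta> x - indicator B x\<bar> \<partial>L) < e"
proof -
  have fm: "finite_measure L" and sL[simp]: "sets L = sets borel" if "L \<in> \<M>" for L
    using M that by (auto simp: borel_finite_measures_def)
  have spL[simp]: "space L = UNIV" if "L \<in> \<M>" for L
    using sets_eq_imp_space_eq[OF sL[OF that]] by simp
  have int: "integrable L (\<lambda>x. \<bar>\<theta> x - indicator A x\<bar>)"
    if "L \<in> \<M>" "continuous_on UNIV \<theta>" "\<forall>x. 0 \<le> \<theta> x \<and> \<theta> x \<le> 1" "A \<in> sets borel"
    for L and \<theta> :: "'a \<Rightarrow> real" and A :: "'a set"
  proof (rule finite_measure.integrable_const_bound[OF fm[OF that(1)], where B=1])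
    note [measurable] = borel_measurable_continuous_onI[OF that(2)] that(4)
    have "(\<lambda>x. \<bar>\<theta> x - indicator A x\<bar>) \<in> borel_measurable borel"
      by measurable
    then show "(\<lambda>x. \<bar>\<theta> x - indicator A x\<bar>) \<in> borel_measurable L"
      using measurable_cong_sets[OF sL[OF that(1)] refl] by blast
  next
    have "\<bar>\<theta> x - indicator A x\<bar> \<le> 1" for x
      using that(3)[rule_format, of x] by (auto simp: indicator_def)
    then show "AE x in L. norm \<bar>\<theta> x - indicator A x\<bar> \<le> 1" by simp
  qed
  let ?P = "\<lambda>A. \<forall>e>0. \<exists>\<theta>. continuous_on UNIV \<theta> \<and> (\<forall>x. 0 \<le> \<theta> x \<and> \<theta> x \<le> (1::real)) \<and>
      (\<forall>L\<in>\<M>. (\<integral>x. \<bar>\<theta> x - indicator A x\<bar> \<partial>L) < e)"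
  have "B \<in> sigma_sets UNIV (Collect closed)"
    using B sets_borel_closed by blast
  then have "?P B"
  proof (rule sigma_sets_induct_disjoint[where P="?P", rotated 2])
    show "Int_stable (Collect closed :: 'a set set)" unfolding Int_stable_def using closed_Int by blast
    show "(Collect closed :: 'a set set) \<subseteq> Pow UNIV" by auto
  next
    fix C :: "'a set" assume "C \<in> Collect closed"
    then have C: "closed C" by simp
    show "?P C"
    proof (cases "C = {}")
      case True
      then show ?thesis by (intro allI impI exI[of _ "\<lambda>_. 0"]) auto
    next
      case False
      define \<theta> where "\<theta> n x = max 0 (1 - real n * infdist x C)" for n :: nat and x
      have cont: "continuous_on UNIV (\<theta> n)" for n
        unfolding \<theta>_def by (intro continuous_intros)
      have bd: "0 \<le> \<theta> n x \<and> \<theta> n x \<le> 1" for n x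
        by (auto simp: \<theta>_def infdist_nonneg)
      have lim: "(\<lambda>n. \<theta> n x) \<longlonglongrightarrow> indicator C x" for x
      proof (cases "x \<in> C")
        case True
        then show ?thesis by (simp add: \<theta>_def)
      next
        case nx: False
        then have pos: "infdist x C > 0"
          using C False infdist_pos_not_in_closed by blast
        obtain N :: nat where N: "1 / infdist x C < N" using reals_Archimedean2 by blast
        have "\<theta> n x = 0" if "n \<ge> N" for n
        proof -
          have "1 / infdist x C \<le> n" using N that by linarith
          then show ?thesis using pos by (simp add: \<theta>_def field_simps)
        qed
        then show ?thesis using nx
          by (intro tendsto_eventually) (auto simp: eventually_sequentially)
      qed
      have lim0: "(\<lambda>n. \<integral>x. \<bar>\<theta> n x - indicator C x\<bar> \<partial>L) \<longlonglongrightarrow> (\<integral>x. 0 \<partial>L)" if L: "L \<in> \<M>" for L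
      proof (rule integral_dominated_convergence[where w="\<lambda>_. 1"])
        show "integrable L (\<lambda>_. 1 :: real)" using fm[OF L] by (simp add: finite_measure.integrable_const)
        show "AE x in L. (\<lambda>n. \<bar>\<theta> n x - indicator C x\<bar>) \<longlonglongrightarrow> 0"
          using lim by (auto simp: tendsto_rabs_zero_iff LIM_zero_iff)
        have "\<bar>\<theta> n x - indicator C x\<bar> \<le> 1" for n x
          using bd[of n x] by (auto simp: indicator_def)
        then show "AE x in L. norm \<bar>\<theta> n x - indicator C x\<bar> \<le> 1" for n by simp
        show "(\<lambda>x. \<bar>\<theta> n x - indicator C x\<bar>) \<in> borel_measurable L" for n
          by (rule borel_measurable_integrable, rule int[OF L cont]) (use bd C in auto)
      qed simp
      then have "\<forall>\<^sub>F n in sequentially. (\<integral>x. \<bar>\<theta> n x - indicator C x\<bar> \<partial>L) < e"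
        if "L \<in> \<M>" "e > 0" for L e
        using order_tendstoD(2)[OF lim0[OF that(1)]] that(2) by simp
      then have "\<forall>\<^sub>F n in sequentially. \<forall>L\<in>\<M>. (\<integral>x. \<bar>\<theta> n x - indicator C x\<bar> \<partial>L) < e" if "e > 0" for e
        using that fin by (simp add: eventually_ball_finite)
      then have ex: "\<exists>n. \<forall>L\<in>\<M>. (\<integral>x. \<bar>\<theta> n x - indicator C x\<bar> \<partial>L) < e" if "e > 0" for e
        using eventually_happens'[OF sequentially_bot] that by blast
      show ?thesis
      proof (intro allI impI)
        fix e :: real assume "e > 0"
        then obtain n where "\<forall>L\<in>\<M>. (\<integral>x. \<bar>\<theta> n x - indicator C x\<bar> \<partial>L) < e" using ex by blast
        then show "\<exists>\<theta>. continuous_on UNIV \<theta> \<and> (\<forall>x. 0 \<le> \<theta> x \<and> \<theta> x \<le> (1::real)) \<and>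
            (\<forall>L\<in>\<M>. (\<integral>x. \<bar>\<theta> x - indicator C x\<bar> \<partial>L) < e)"
          using cont bd by (intro exI[of _ "\<theta> n"]) simp
      qed
    qed
  next
    show "?P {}" by (intro allI impI exI[of _ "\<lambda>_. 0"]) auto
  next
    fix A :: "'a set" assume compl: "?P A"
    show "?P (UNIV - A)"
    proof (intro allI impI)
      fix e :: real assume "e > 0"
      then obtain \<theta> where t: "continuous_on UNIV \<theta>" "\<forall>x. 0 \<le> \<theta> x \<and> \<theta> x \<le> (1::real)"
        "\<forall>L\<in>\<M>. (\<integral>x. \<bar>\<theta> x - indicator A x\<bar> \<partial>L) < e" using compl by blast
      have "\<bar>(1 - \<theta> x) - indicator (UNIV - A) x\<bar> = \<bar>\<theta> x - indicator A x\<bar>" for x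
        by (auto simp: indicator_def)
      then show "\<exists>\<theta>. continuous_on UNIV \<theta> \<and> (\<forall>x. 0 \<le> \<theta> x \<and> \<theta> x \<le> (1::real)) \<and>
          (\<forall>L\<in>\<M>. (\<integral>x. \<bar>\<theta> x - indicator (UNIV - A) x\<bar> \<partial>L) < e)"
        using t by (intro exI[of _ "\<lambda>x. 1 - \<theta> x"]) (auto intro!: continuous_intros)
    qed
  next
    fix A :: "nat \<Rightarrow> 'a set"
    assume union: "disjoint_family A" "range A \<subseteq> sigma_sets UNIV (Collect closed)" "\<And>i. ?P (A i)"
    then have Am[measurable]: "A i \<in> sets borel" for i using sets_borel_closed by blast
    show "?P (\<Union>i. A i)"
    proof (intro allI impI)
      fix e :: real assume e: "e > 0"
      have "(\<lambda>n. measure L (\<Union>i<n. A i)) \<longlonglongrightarrow> measure L (\<Union>n. \<Union>i<n. A i)" if L: "L \<in> \<M>" for L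
        using L finite_measure.finite_Lim_measure_incseq[OF fm[OF L], of "\<lambda>n. \<Union>i<n. A i"]
        by (force simp: incseq_def)
      moreover have eq: "(\<Union>n. \<Union>i<n. A i) = (\<Union>i. A i)" by blast
      ultimately have "\<forall>\<^sub>F n in sequentially. measure L (\<Union>i. A i) - e/2 < measure L (\<Union>i<n. A i)" if L: "L \<in> \<M>" for L
        using L e by (intro order_tendstoD(1)[where y="measure L (\<Union>i. A i)"]) auto
      then have "\<forall>\<^sub>F n in sequentially. \<forall>L\<in>\<M>. measure L (\<Union>i. A i) - e/2 < measure L (\<Union>i<n. A i)"
        using fin by (simp add: eventually_ball_finite)
      then obtain N where N: "\<And>L. L \<in> \<M> \<Longrightarrow> measure L (\<Union>i. A i) - e/2 < measure L (\<Union>i<N. A i)"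
        using eventually_happens'[OF sequentially_bot] by blast
      have "e / (2 * Suc N) > 0" using e by simp
      then have "\<exists>\<theta>. continuous_on UNIV \<theta> \<and> (\<forall>x. 0 \<le> \<theta> x \<and> \<theta> x \<le> (1::real)) \<and>
          (\<forall>L\<in>\<M>. (\<integral>x. \<bar>\<theta> x - indicator (A i) x\<bar> \<partial>L) < e / (2 * Suc N))" for i
        using union(3) by blast
      then obtain \<theta> where t: "\<And>i. continuous_on UNIV (\<theta> i)" "\<And>i x. 0 \<le> \<theta> i x \<and> \<theta> i x \<le> (1::real)"
        "\<And>i L. L \<in> \<M> \<Longrightarrow> (\<integral>x. \<bar>\<theta> i x - indicator (A i) x\<bar> \<partial>L) < e / (2 * Suc N)" by metis
      \<comment> \<open>Truncation at 1 keeps the weight in the unit interval and costs nothing, since the sets are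
        disjoint.\<close>
      define \<eta> where "\<eta> x = min 1 (\<Sum>i<N. \<theta> i x)" for x
      have \<eta>: "continuous_on UNIV \<eta>" "\<forall>x. 0 \<le> \<eta> x \<and> \<eta> x \<le> 1"
        unfolding \<eta>_def using t by (auto intro!: continuous_intros sum_nonneg)
      define D where "D = (\<Union>i. A i) - (\<Union>i<N. A i)"
      have [measurable]: "D \<in> sets borel" unfolding D_def by measurable
      have pw: "\<bar>\<eta> x - indicator (\<Union>i. A i) x\<bar> \<le> (\<Sum>i<N. \<bar>\<theta> i x - indicator (A i) x\<bar>) + indicator D x" for x
      proof -
        have u: "indicator (\<Union>i<N. A i) x = (\<Sum>i<N. indicator (A i) x :: real)"
          using union(1) by (subst indicator_UN_disjoint) (auto simp: disjoint_family_on_def)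
        have "\<bar>\<eta> x - indicator (\<Union>i<N. A i) x\<bar> \<le> \<bar>(\<Sum>i<N. \<theta> i x) - indicator (\<Union>i<N. A i) x\<bar>"
          using t(2) by (auto simp: \<eta>_def indicator_def min_def)
        also have "\<dots> \<le> (\<Sum>i<N. \<bar>\<theta> i x - indicator (A i) x\<bar>)"
          unfolding u sum_subtractf[symmetric] by (rule sum_abs)
        moreover have "indicator (\<Union>i. A i) x = (indicator (\<Union>i<N. A i) x + indicator D x :: real)"
          unfolding D_def by (auto simp: indicator_def)
        moreover have "0 \<le> (indicator D x :: real)" by simp
        ultimately show ?thesis by linarith
      qed
      have "(\<integral>x. \<bar>\<eta> x - indicator (\<Union>i. A i) x\<bar> \<partial>L) < e" if L: "L \<in> \<M>" for L
      proof -
        interpret L: finite_measure L by (rule fm[OF L])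
        have DL: "D \<in> sets L" using L by simp
        have i1: "integrable L (\<lambda>x. \<bar>\<theta> i x - indicator (A i) x\<bar>)" for i
          using t by (intro int[OF L]) auto
        have i2: "integrable L (indicator D :: 'a \<Rightarrow> real)"
          using DL by (intro integrable_real_indicator) (auto simp: L.emeasure_finite less_top[symmetric])
        have "(\<integral>x. \<bar>\<eta> x - indicator (\<Union>i. A i) x\<bar> \<partial>L)
            \<le> (\<integral>x. (\<Sum>i<N. \<bar>\<theta> i x - indicator (A i) x\<bar>) + indicator D x \<partial>L)"
          using i1 i2 pw \<eta> by (intro integral_mono int[OF L]) auto
        also have "\<dots> = (\<Sum>i<N. \<integral>x. \<bar>\<theta> i x - indicator (A i) x\<bar> \<partial>L) + measure L D"
          using i1 i2 L by (subst Bochner_Integration.integral_add) auto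
        also have "measure L D = measure L (\<Union>i. A i) - measure L (\<Union>i<N. A i)"
          unfolding D_def using L by (intro L.finite_measure_Diff) auto
        also have "\<dots> < e / 2" using N[OF L] by linarith
        also have "(\<Sum>i<N. \<integral>x. \<bar>\<theta> i x - indicator (A i) x\<bar> \<partial>L) \<le> (\<Sum>i<N. e / (2 * Suc N))"
          using t(3)[OF L] by (intro sum_mono) (auto intro: less_imp_le)
        also have "\<dots> \<le> e / 2" using e by (simp add: field_simps)
        finally show ?thesis by simp
      qed
      then show "\<exists>\<theta>. continuous_on UNIV \<theta> \<and> (\<forall>x. 0 \<le> \<theta> x \<and> \<theta> x \<le> (1::real)) \<and>
          (\<forall>L\<in>\<M>. (\<integral>x. \<bar>\<theta> x - indicator (\<Union>i. A i) x\<bar> \<partial>L) < e)"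
        using \<eta> by blast
    qed
  qed
  then show ?thesis using that e by metis
qed

lemma measure_eqI_continuous_integrals:
  fixes M N :: "'a::metric_space measure"
  assumes M: "M \<in> borel_finite_measures" and N: "N \<in> borel_finite_measures"
    and eq: "\<And>f :: 'a \<Rightarrow> real. continuous_on UNIV f \<Longrightarrow> bounded (range f) \<Longrightarrow> integral\<^sup>L M f = integral\<^sup>L N f"
  shows "M = N"
proof (rule measure_eqI)
  interpret M: finite_measure M using M by (simp add: borel_finite_measures_def)
  interpret N: finite_measure N using N by (simp add: borel_finite_measures_def)
  have sets[simp, measurable_cong]: "sets M = sets borel" "sets N = sets borel"
    using M N by (auto simp: borel_finite_measures_def)
  show "sets M = sets N" by simp
  fix B assume "B \<in> sets M"
  then have [measurable]: "B \<in> sets borel" by simp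
  have "\<bar>measure M B - measure N B\<bar> \<le> 0 + e" if "e > 0" for e
  proof -
    obtain \<theta> :: "'a \<Rightarrow> real" where t: "continuous_on UNIV \<theta>" "\<And>x. 0 \<le> \<theta> x \<and> \<theta> x \<le> 1"
      "\<And>L. L \<in> {M, N} \<Longrightarrow> (\<integral>x. \<bar>\<theta> x - indicator B x\<bar> \<partial>L) < e / 2"
      using continuous_approx_indicator[of "{M, N}" B "e / 2"] M N \<open>e > 0\<close> by auto
    have [measurable]: "\<theta> \<in> borel_measurable borel" using t(1) by (rule borel_measurable_continuous_onI)
    have "bounded (range \<theta>)" using t(2) by (intro boundedI[of _ 1]) auto
    then have eq': "integral\<^sup>L M \<theta> = integral\<^sup>L N \<theta>" using eq t(1) by blast
    have i: "integrable M \<theta>" "integrable N \<theta>"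
      "integrable M (indicator B :: 'a \<Rightarrow> real)" "integrable N (indicator B :: 'a \<Rightarrow> real)"
      using t(2) by (auto intro!: M.integrable_const_bound[where B=1] N.integrable_const_bound[where B=1])
    have "\<bar>integral\<^sup>L M \<theta> - measure M B\<bar> \<le> (\<integral>x. \<bar>\<theta> x - indicator B x\<bar> \<partial>M)"
      using i integral_abs_bound[of M "\<lambda>x. \<theta> x - indicator B x"] by simp
    moreover have "\<bar>integral\<^sup>L N \<theta> - measure N B\<bar> \<le> (\<integral>x. \<bar>\<theta> x - indicator B x\<bar> \<partial>N)"
      using i integral_abs_bound[of N "\<lambda>x. \<theta> x - indicator B x"] by simp
    ultimately show ?thesis using t(3)[of M] t(3)[of N] eq' by simp
  qed
  then have "\<bar>measure M B - measure N B\<bar> \<le> 0" by (rule field_le_epsilon)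
  then show "emeasure M B = emeasure N B"
    by (simp add: M.emeasure_eq_measure N.emeasure_eq_measure)
qed

section \<open>Coding points of a compact metric space by real numbers\<close>

text \<open>Base four with digits 0 and 1 makes the expansion unambiguous: the tail after any digit is at
  most 1/3, so no carry can occur and each digit is read off by a floor.\<close>
lemma digit_of_base_four_series:
  fixes b :: "nat \<Rightarrow> bool"
  defines "h \<equiv> (\<Sum>i. of_bool (b i) * (1/4::real) ^ Suc i)"
  shows "0 \<le> h" "h < 1" "\<lfloor>4 ^ Suc j * h\<rfloor> mod 4 = of_bool (b j)"
proof -
  have geo: "(\<lambda>i. (1/4::real) ^ Suc i) sums (1/3)"
    using sums_mult[OF geometric_sums[of "1/4::real"], of "1/4"] by simp
  have summ: "summable (\<lambda>i. of_bool (b (i + k)) * (1/4::real) ^ Suc i)" for k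
    by (rule summable_comparison_test'[OF sums_summable[OF geo], of 0]) (auto simp: abs_mult)
  have bnd: "0 \<le> (\<Sum>i. of_bool (b (i + k)) * (1/4::real) ^ Suc i)"
    "(\<Sum>i. of_bool (b (i + k)) * (1/4::real) ^ Suc i) \<le> 1/3" for k
  proof -
    show "0 \<le> (\<Sum>i. of_bool (b (i + k)) * (1/4::real) ^ Suc i)"
      by (intro suminf_nonneg summ) auto
    have "(\<Sum>i. of_bool (b (i + k)) * (1/4::real) ^ Suc i) \<le> (\<Sum>i. (1/4::real) ^ Suc i)"
      by (intro suminf_le summ sums_summable[OF geo]) auto
    then show "(\<Sum>i. of_bool (b (i + k)) * (1/4::real) ^ Suc i) \<le> 1/3"
      using sums_unique[OF geo] by simp
  qed
  show "0 \<le> h" "h < 1" using bnd[of 0] by (auto simp: h_def)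
  define z :: int where "z = (\<Sum>i<j. of_bool (b i) * 4 ^ (j - Suc i))"
  define t where "t = (\<Sum>i. of_bool (b (i + Suc j)) * (1/4::real) ^ Suc i)"
  have "h = (\<Sum>i. of_bool (b (i + Suc j)) * (1/4::real) ^ Suc (i + Suc j))
      + (\<Sum>i<Suc j. of_bool (b i) * (1/4::real) ^ Suc i)"
    unfolding h_def using suminf_split_initial_segment[OF summ[of 0], of "Suc j"] by simp
  also have "(\<Sum>i. of_bool (b (i + Suc j)) * (1/4::real) ^ Suc (i + Suc j)) = (1/4) ^ Suc j * t"
    unfolding t_def by (subst suminf_mult[symmetric, OF summ]) (simp add: power_add mult_ac)
  finally have "4 ^ Suc j * h = 4 ^ Suc j * ((1/4) ^ Suc j * t)
      + 4 ^ Suc j * (\<Sum>i<Suc j. of_bool (b i) * (1/4::real) ^ Suc i)"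
    by (simp add: distrib_left)
  also have "4 ^ Suc j * ((1/4) ^ Suc j * t) = t"
    by (simp add: power_one_over field_simps)
  also have "4 ^ Suc j * (\<Sum>i<Suc j. of_bool (b i) * (1/4::real) ^ Suc i)
      = (\<Sum>i<Suc j. of_bool (b i) * 4 ^ (j - i))"
    unfolding sum_distrib_left
  proof (rule sum.cong)
    fix i assume "i \<in> {..<Suc j}"
    then have "(4::real) ^ Suc j = 4 ^ Suc i * 4 ^ (j - i)" by (simp flip: power_add)
    then show "4 ^ Suc j * (of_bool (b i) * (1/4::real) ^ Suc i) = of_bool (b i) * 4 ^ (j - i)"
      by (simp add: power_one_over)
  qed simp
  also have "(\<Sum>i<Suc j. of_bool (b i) * (4::real) ^ (j - i)) = (\<Sum>i<j. of_bool (b i) * 4 ^ (j - i)) + of_bool (b j)"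
    by simp
  also have "(\<Sum>i<j. of_bool (b i) * (4::real) ^ (j - i)) = (\<Sum>i<j. 4 * (of_bool (b i) * 4 ^ (j - Suc i)))"
  proof (rule sum.cong)
    fix i assume "i \<in> {..<j}"
    then have "j - i = Suc (j - Suc i)" by auto
    then have "(4::real) ^ (j - i) = 4 * 4 ^ (j - Suc i)" by (metis power_Suc)
    then show "of_bool (b i) * (4::real) ^ (j - i) = 4 * (of_bool (b i) * 4 ^ (j - Suc i))" by simp
  qed simp
  also have "\<dots> = 4 * of_int z" by (simp add: z_def sum_distrib_left del: sum_of_bool_mult_eq sum_mult_of_bool_eq)
  finally have "4 ^ Suc j * h = of_int (4 * z + of_bool (b j)) + t" by simp
  moreover have "0 \<le> t" "t < 1" using bnd[of "Suc j"] by (auto simp: t_def)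
  ultimately have "\<lfloor>4 ^ Suc j * h\<rfloor> = 4 * z + of_bool (b j)" by (intro floor_unique) auto
  then show "\<lfloor>4 ^ Suc j * h\<rfloor> mod 4 = of_bool (b j)"
    by (auto simp: of_bool_def)
qed

lemma dist_geometric_convergent:
  fixes x :: "nat \<Rightarrow> 'a::metric_space"
  assumes "compact (UNIV :: 'a::metric_space set)" and d: "\<And>n. dist (x n) (x (Suc n)) \<le> C * (1/2) ^ n"
  shows "convergent x"
proof -
  have tail: "dist (x m) (x (m + k)) \<le> 2 * C * (1/2) ^ m - 2 * C * (1/2) ^ (m + k)" for m k
  proof (induction k)
    case (Suc k)
    have "dist (x m) (x (m + Suc k)) \<le> dist (x m) (x (m + k)) + dist (x (m + k)) (x (Suc (m + k)))"
      using dist_triangle[of "x m" "x (m + Suc k)" "x (m + k)"] by simp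
    also have "\<dots> \<le> (2 * C * (1/2) ^ m - 2 * C * (1/2) ^ (m + k)) + C * (1/2) ^ (m + k)"
      using Suc d by (intro add_mono)
    finally show ?case by simp
  qed simp
  have C: "0 \<le> C" using d[of 0] order_trans[OF zero_le_dist[of "x 0" "x (Suc 0)"]] by simp
  have "Cauchy x"
    unfolding Cauchy_altdef2
  proof (intro allI impI)
    fix e :: real assume "e > 0"
    then obtain N where N: "2 * C * (1/2) ^ N < e"
      using order_tendstoD(2)[OF tendsto_mult[OF tendsto_const LIMSEQ_power_zero[of "1/2::real"]], of "2 * C" e]
      by (auto simp: eventually_sequentially)
    have "dist (x n) (x N) < e" if n: "n \<ge> N" for n
    proof -
      obtain k where k: "n = N + k" using n le_Suc_ex by blast
      have "0 \<le> 2 * C * (1/2) ^ (N + k)" using C by simp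
      then show ?thesis using tail[of N k] N unfolding k by (simp add: dist_commute)
    qed
    then show "\<exists>N. \<forall>n\<ge>N. dist (x n) (x N) < e" by blast
  qed
  then show ?thesis
    using compact_imp_complete[OF assms(1)] unfolding complete_def convergent_def by blast
qed

text \<open>A point is coded by the sequence of indices \<open>f n y\<close> of points of a dense sequence within
  \<open>(1/2) ^ n\<close> of it; the graph of this sequence is written with digits 0 and 1. Decoding must be Borel on the whole line, also at reals
  that code nothing. There the decoded indices are filtered: a new index is accepted only if its
  point is close to the previous one, so that the points always converge.\<close>
lemma compact_metric_real_coding:
  assumes "compact (UNIV :: 'b::metric_space set)"
  obtains h :: "'b::metric_space \<Rightarrow> real" and g :: "real \<Rightarrow> 'b"
  where "h \<in> borel_measurable borel" "g \<in> borel_measurable borel" "\<And>y. g (h y) = y"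
    "\<And>y. 0 \<le> h y \<and> h y < 1"
proof -
  obtain d :: "nat \<Rightarrow> 'b" where dense: "\<And>y e. e > 0 \<Longrightarrow> \<exists>i. dist y (d i) < e"
    using compact_metric_dense_sequence[OF assms] by blast
  define f where "f n y = (LEAST i. dist y (d i) < (1/2) ^ n)" for n :: nat and y
  have f: "dist y (d (f n y)) < (1/2) ^ n" for n y
    unfolding f_def using dense[of "(1/2) ^ n" y] by (intro LeastI_ex[where P="\<lambda>i. dist y (d i) < (1/2) ^ n"]) simp
  define bit where "bit j y \<longleftrightarrow> f (fst (prod_decode j)) y = snd (prod_decode j)" for j y
  define h where "h y = (\<Sum>j. of_bool (bit j y) * (1/4::real) ^ Suc j)" for y
  define digit where "digit j r \<longleftrightarrow> \<lfloor>4 ^ Suc j * r\<rfloor> mod 4 = 1" for j and r :: real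
  define dec where "dec n r = (LEAST i. digit (prod_encode (n, i)) r)" for n r
  have digit_h: "digit j (h y) \<longleftrightarrow> bit j y" for j y
    using digit_of_base_four_series(3)[where b="\<lambda>j. bit j y"] by (auto simp: digit_def h_def)
  have dec_h: "dec n (h y) = f n y" for n y
    unfolding dec_def by (rule Least_equality) (auto simp: digit_h bit_def)
  define w where "w = rec_nat (dec 0) (\<lambda>n v r. if dist (d (v r)) (d (dec (Suc n) r)) < 2 * (1/2) ^ n
      then dec (Suc n) r else v r)"
  have w0: "w 0 r = dec 0 r" for r by (simp add: w_def)
  have wS: "w (Suc n) r = (if dist (d (w n r)) (d (dec (Suc n) r)) < 2 * (1/2) ^ n
      then dec (Suc n) r else w n r)" for n r by (simp add: w_def)
  \<comment> \<open>On genuine codes the filter never rejects, because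
    \<open>(1/2) ^ n + (1/2) ^ Suc n < 2 * (1/2) ^ n\<close>.\<close>
  have w_h: "w n (h y) = f n y" for n y
  proof (induction n)
    case (Suc n)
    have "dist (d (f n y)) (d (f (Suc n) y)) \<le> dist y (d (f n y)) + dist y (d (f (Suc n) y))"
      by (rule dist_triangle3)
    also have "\<dots> < (1/2) ^ n + (1/2) ^ Suc n" using f by (intro add_strict_mono)
    also have "\<dots> \<le> 2 * (1/2) ^ n" by simp
    finally show ?case by (simp add: wS Suc dec_h)
  qed (simp add: w0 dec_h)
  have "dist (d (w n r)) (d (w (Suc n) r)) \<le> 2 * (1/2) ^ n" for n r
    by (auto simp: wS intro: less_imp_le)
  then have "convergent (\<lambda>n. d (w n r))" for r
    by (rule dist_geometric_convergent[OF assms])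
  then have "\<exists>z. (\<lambda>n. d (w n r)) \<longlonglongrightarrow> z" for r by (simp add: convergent_def)
  then obtain g where g: "\<And>r. (\<lambda>n. d (w n r)) \<longlonglongrightarrow> g r" by metis
  show ?thesis
  proof (rule that)
    show "g (h y) = y" for y
    proof (rule LIMSEQ_unique[OF g])
      have "(\<lambda>n. dist (d (f n y)) y) \<longlonglongrightarrow> 0"
      proof (rule tendsto_sandwich[OF _ _ tendsto_const LIMSEQ_power_zero[of "1/2::real"]])
        show "\<forall>\<^sub>F n in sequentially. dist (d (f n y)) y \<le> (1/2) ^ n"
          by (intro always_eventually allI) (metis f less_imp_le dist_commute)
      qed auto
      then show "(\<lambda>n. d (w n (h y))) \<longlonglongrightarrow> y"
        unfolding w_h by (rule tendsto_dist_iff[THEN iffD2])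
    qed
    show "0 \<le> h y \<and> h y < 1" for y
      using digit_of_base_four_series(1,2)[of "\<lambda>j. bit j y"] by (simp add: h_def)
    have [measurable]: "(\<lambda>y. dist y (d i)) \<in> borel_measurable borel" for i
      by (intro borel_measurable_continuous_onI continuous_intros)
    have [measurable]: "f n \<in> borel \<rightarrow>\<^sub>M count_space UNIV" for n
      unfolding f_def by measurable
    have [measurable]: "Measurable.pred borel (bit j)" for j
      unfolding bit_def by measurable
    show "h \<in> borel_measurable borel" unfolding h_def by measurable
    have [measurable]: "Measurable.pred borel (digit j)" for j
      unfolding digit_def by measurable
    have [measurable]: "dec n \<in> borel \<rightarrow>\<^sub>M count_space UNIV" for n
      unfolding dec_def by measurable
    have [measurable]: "w n \<in> borel \<rightarrow>\<^sub>M count_space UNIV" for n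
    proof (induction n)
      case 0
      have "w 0 = dec 0" by (rule ext) (rule w0)
      then show ?case by simp
    next
      case (Suc n)
      note [measurable] = Suc
      have [measurable]: "Measurable.pred borel (\<lambda>r. dist (d (w n r)) (d (dec (Suc n) r)) < 2 * (1/2) ^ n)"
        by measurable
      have "w (Suc n) = (\<lambda>r. if dist (d (w n r)) (d (dec (Suc n) r)) < 2 * (1/2) ^ n
        then dec (Suc n) r else w n r)" by (rule ext) (rule wS)
      then show ?case by simp
    qed
    show "g \<in> borel_measurable borel"
    proof (rule borel_measurable_LIMSEQ_metric[OF _ g])
      show "(\<lambda>r. d (w n r)) \<in> borel_measurable borel" for n
        by (rule measurable_compose[where N="count_space UNIV"]) auto
    qed
  qed
qed

section \<open>Disintegration\<close>
lemma AE_le_of_set_integrals_le: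
  fixes f g :: "'a \<Rightarrow> ennreal"
  assumes [measurable]: "f \<in> borel_measurable M" "g \<in> borel_measurable M"
    and fin: "(\<integral>\<^sup>+x. f x \<partial>M) \<noteq> top"
    and le: "\<And>A. A \<in> sets M \<Longrightarrow> (\<integral>\<^sup>+x\<in>A. f x \<partial>M) \<le> (\<integral>\<^sup>+x\<in>A. g x \<partial>M)"
  shows "AE x in M. f x \<le> g x"
proof -
  define A where "A = {x \<in> space M. g x < f x}"
  have [measurable]: "A \<in> sets M" unfolding A_def by measurable
  have gf: "g x * indicator A x \<le> f x * indicator A x" for x
    by (auto simp: A_def indicator_def)
  have fA: "(\<integral>\<^sup>+x\<in>A. f x \<partial>M) < top"
  proof (rule le_less_trans)
    show "(\<integral>\<^sup>+x\<in>A. f x \<partial>M) \<le> (\<integral>\<^sup>+x. f x \<partial>M)"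
      by (intro nn_integral_mono) (auto simp: indicator_def)
  qed (use fin in \<open>simp add: less_top\<close>)
  have gA: "(\<integral>\<^sup>+x\<in>A. g x \<partial>M) \<noteq> top"
    using fA nn_integral_mono[of M "\<lambda>x. g x * indicator A x" "\<lambda>x. f x * indicator A x"] gf by (auto simp: top_unique)
  have "(\<integral>\<^sup>+x. f x * indicator A x - g x * indicator A x \<partial>M) = (\<integral>\<^sup>+x\<in>A. f x \<partial>M) - (\<integral>\<^sup>+x\<in>A. g x \<partial>M)"
    using gf gA by (intro nn_integral_diff) auto
  also have "\<dots> = 0" using fA by (intro diff_eq_0_ennreal le) auto
  finally have "AE x in M. f x * indicator A x - g x * indicator A x = 0"
    by (subst (asm) nn_integral_0_iff_AE) auto
  then show ?thesis
    using AE_space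
  proof eventually_elim
    case (elim x)
    show ?case
    proof (rule ccontr)
      assume "\<not> f x \<le> g x"
      then show False using elim by (auto simp: A_def diff_eq_0_iff_ennreal)
    qed
  qed
qed

text \<open>Any values at the rationals turn into a distribution function by taking the infimum over
  rationals to the right. The infimum itself creates monotonicity and right continuity, so arbitrary
  versions of conditional probabilities yield a distribution function at every \<open>x\<close>.\<close>
lemma right_continuous_envelope:
  fixes H :: "real \<Rightarrow> real"
  assumes H0: "\<And>r. r < 0 \<Longrightarrow> H r = 0" and H1: "\<And>r. 1 \<le> r \<Longrightarrow> H r = 1"
    and H: "\<And>r. 0 \<le> H r \<and> H r \<le> 1"
  defines "F \<equiv> \<lambda>t. INF r\<in>{r\<in>\<rat>. t < r}. H r"
  shows "\<And>s t. s \<le> t \<Longrightarrow> F s \<le> F t" "\<And>t. continuous (at_right t) F"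
    "(F \<longlongrightarrow> 0) at_bot" "(F \<longlongrightarrow> 1) at_top" "\<And>t. 0 \<le> F t"
proof -
  have ne: "{r\<in>\<rat>. t < r} \<noteq> {}" for t :: real using Rats_dense_in_real[of t "t+1"] by auto
  have bdd: "bdd_below (H ` S)" for S using H by (intro bdd_belowI[of _ 0]) auto
  show nn: "0 \<le> F t" for t unfolding F_def using ne H by (intro cINF_greatest) auto
  show mono: "s \<le> t \<Longrightarrow> F s \<le> F t" for s t
    unfolding F_def using ne bdd by (intro cINF_superset_mono) auto
  have upper: "F t \<le> H r" if "r \<in> \<rat>" "t < r" for r t
    unfolding F_def using that bdd by (intro cINF_lower) auto
  show "continuous (at_right t) F" for t
  proof (subst continuous_at_right_real_increasing[OF mono], assumption, intro allI impI)
    fix e :: real assume "e > 0"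
    then have "F t < F t + e" by simp
    then obtain r where r: "r \<in> \<rat>" "t < r" "H r < F t + e"
      unfolding F_def using ne bdd by (subst (asm) (1) cINF_less_iff) auto
    obtain u where u: "t < u" "u < r" using dense[OF r(2)] by blast
    have "F (t + (u - t)) \<le> H r" using upper[OF r(1)] u by simp
    then show "\<exists>d>0. F (t + d) - F t < e" using r u by (intro exI[of _ "u - t"]) auto
  qed
  have "F t = 0" if t: "t < 0" for t
  proof -
    obtain r where "r \<in> \<rat>" "t < r" "r < 0" using Rats_dense_in_real[OF t] by auto
    then show ?thesis using upper[of r t] H0[of r] nn[of t] by simp
  qed
  then show "(F \<longlongrightarrow> 0) at_bot"
    by (intro tendsto_eventually eventually_at_bot_linorderI[of "-1"]) auto
  have "F t = 1" if "1 \<le> t" for t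
  proof -
    have "H ` {r\<in>\<rat>. t < r} = {1}" using ne[of t] H1 that by fastforce
    then show ?thesis by (simp add: F_def)
  qed
  then show "(F \<longlongrightarrow> 1) at_top"
    by (intro tendsto_eventually eventually_at_top_linorderI[of 1]) auto
qed

lemma emeasure_distr_restricted:
  assumes [measurable]: "A \<in> sets M" "f \<in> M \<rightarrow>\<^sub>M N" "C \<in> sets N"
  shows "emeasure (distr (density M (indicator A)) N f) C = emeasure M (A \<inter> (f -` C \<inter> space M))"
proof -
  have "emeasure (distr (density M (indicator A)) N f) C
      = (\<integral>\<^sup>+x. indicator A x * indicator (f -` C \<inter> space M) x \<partial>M)"
    by (subst emeasure_distr) (auto simp: emeasure_density)
  also have "\<dots> = (\<integral>\<^sup>+x. indicator (A \<inter> (f -` C \<inter> space M)) x \<partial>M)"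
    by (intro nn_integral_cong) (auto simp: indicator_def)
  finally show ?thesis by simp
qed

text \<open>The density \<open>G t\<close> of \<open>A \<mapsto> P (X \<in> A, h \<le> t)\<close> with respect to the law of \<open>X\<close> plays the role of
  the conditional probability of \<open>h \<le> t\<close>. The envelope \<open>F\<close> of its values at rationals lies almost
  surely between \<open>G t\<close> and every \<open>G r\<close> with rational \<open>r > t\<close>; letting \<open>r\<close> decrease to \<open>t\<close> identifies
  the integral of \<open>F x t\<close> over \<open>A\<close>.\<close>
lemma real_conditional_distribution:
  fixes P :: "'w measure" and h :: "'w \<Rightarrow> real"
  assumes P: "prob_space P" and X[measurable]: "X \<in> P \<rightarrow>\<^sub>M S" and h[measurable]: "h \<in> borel_measurable P"
    and h01: "\<And>\<omega>. \<omega> \<in> space P \<Longrightarrow> 0 \<le> h \<omega> \<and> h \<omega> < 1"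
  shows "\<exists>\<kappa>\<in>S \<rightarrow>\<^sub>M prob_algebra borel. \<forall>A\<in>sets S. \<forall>B\<in>sets borel.
    emeasure P {\<omega> \<in> space P. X \<omega> \<in> A \<and> h \<omega> \<in> B} = (\<integral>\<^sup>+x\<in>A. emeasure (\<kappa> x) B \<partial>distr P S X)"
proof -
  interpret P: prob_space P by fact
  define Q where "Q = distr P S X"
  interpret Q: prob_space Q unfolding Q_def by (rule P.prob_space_distr) simp
  have sQ[simp, measurable_cong]: "sets Q = sets S" by (simp add: Q_def)
  have spQ[simp]: "space Q = space S" by (simp add: Q_def)
  define E where "E A t = {\<omega> \<in> space P. X \<omega> \<in> A \<and> h \<omega> \<le> t}" for A t
  have [measurable]: "E A t \<in> sets P" if [measurable]: "A \<in> sets S" for A t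
    unfolding E_def by measurable
  define N where "N t = distr (density P (indicator {\<omega> \<in> space P. h \<omega> \<le> t})) S X" for t
  have sN[simp]: "sets (N t) = sets S" for t by (simp add: N_def)
  have N: "emeasure (N t) A = emeasure P (E A t)" if [measurable]: "A \<in> sets S" for A t
    unfolding N_def by (subst emeasure_distr_restricted)
      (auto simp: E_def intro!: arg_cong[where f="emeasure P"])
  have QA: "emeasure Q A = emeasure P {\<omega> \<in> space P. X \<omega> \<in> A}" if [measurable]: "A \<in> sets S" for A
    unfolding Q_def by (subst emeasure_distr) (auto intro!: arg_cong[where f="emeasure P"])
  have NQ: "emeasure (N t) A \<le> emeasure Q A" if "A \<in> sets S" for A t
    unfolding N[OF that] QA[OF that] using that by (intro emeasure_mono) (auto simp: E_def)
  have ac: "absolutely_continuous Q (N t)" for t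
    unfolding absolutely_continuous_def
    using NQ by (auto simp: null_sets_def) (metis le_zero_eq)
  define G where "G t = RN_deriv Q (N t)" for t
  have Gm[measurable]: "G t \<in> borel_measurable S" for t
    using borel_measurable_RN_deriv[of Q "N t"] by (simp add: G_def cong: measurable_cong_sets)
  have G: "(\<integral>\<^sup>+x\<in>A. G t x \<partial>Q) = emeasure P (E A t)" if A: "A \<in> sets S" for A t
  proof -
    have "density Q (G t) = N t" unfolding G_def by (rule Q.density_RN_deriv[OF ac]) simp
    then have "emeasure (density Q (G t)) A = emeasure (N t) A" by simp
    then show ?thesis using A by (simp add: emeasure_density N)
  qed
  have Gfin: "(\<integral>\<^sup>+x. G t x \<partial>Q) \<noteq> top" for t
  proof -
    have "(\<integral>\<^sup>+x. G t x \<partial>Q) = (\<integral>\<^sup>+x\<in>space S. G t x \<partial>Q)" by (intro nn_integral_cong) auto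
    then show ?thesis using G[of "space S" t] by (simp add: P.emeasure_finite)
  qed
  have Gmono: "AE x in Q. G s x \<le> G t x" if "s \<le> t" for s t
    using that by (intro AE_le_of_set_integrals_le) (auto simp: G Gfin E_def intro!: emeasure_mono)
  have G1: "AE x in Q. G t x \<le> 1" for t
    using NQ N by (intro AE_le_of_set_integrals_le) (auto simp: G Gfin)
  have G0: "AE x in Q. G t x \<le> 0" if "t < 0" for t
    using that h01 by (intro AE_le_of_set_integrals_le) (auto simp: G Gfin E_def not_le intro!: emeasure_eq_0_AE AE_I2 dest!: le_less_trans)
  have G1': "AE x in Q. 1 \<le> G t x" if "1 \<le> t" for t
  proof (intro AE_le_of_set_integrals_le)
    show "(\<integral>\<^sup>+x\<in>A. 1 \<partial>Q) \<le> (\<integral>\<^sup>+x\<in>A. G t x \<partial>Q)" if A: "A \<in> sets Q" for A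
    proof -
      have [measurable]: "A \<in> sets S" using A by simp
      have "{\<omega> \<in> space P. X \<omega> \<in> A} = E A t" using h01 \<open>1 \<le> t\<close> by (fastforce simp: E_def)
      then show ?thesis using A by (simp add: G QA)
    qed
  qed (auto simp: Q.emeasure_space_1)
  \<comment> \<open>The values outside \<open>[0, 1)\<close> are prescribed so that the limits at both ends hold at every \<open>x\<close>, not
    only almost everywhere.\<close>
  define H where "H r x = (if r < 0 then 0 else if 1 \<le> r then 1 else min 1 (enn2real (G r x)))" for r x
  have H_meas[measurable]: "(\<lambda>x. H r x) \<in> borel_measurable S" for r unfolding H_def by measurable
  define F where "F x t = (INF r\<in>{r\<in>\<rat>. t < r}. H r x)" for x t
  have Hx: "r < 0 \<Longrightarrow> H r x = 0" "1 \<le> r \<Longrightarrow> H r x = 1" "0 \<le> H r x \<and> H r x \<le> 1" for r x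
    by (auto simp: H_def)
  have Feq: "F x = (\<lambda>t. INF r\<in>{r\<in>\<rat>. t < r}. H r x)" for x
    by (rule ext) (rule F_def)
  have Fprops: "s \<le> t \<Longrightarrow> F x s \<le> F x t" "continuous (at_right t) (F x)"
    "(F x \<longlongrightarrow> 0) at_bot" "(F x \<longlongrightarrow> 1) at_top" "0 \<le> F x t" for x s t
    unfolding Feq by (rule right_continuous_envelope[of "\<lambda>r. H r x", OF Hx]; assumption)+
  have F_meas[measurable]: "(\<lambda>x. F x t) \<in> borel_measurable S" for t
    unfolding F_def by (intro borel_measurable_cINF_real countable_Collect countable_rat) (auto intro: countable_subset[OF _ countable_rat])
  define \<kappa> where "\<kappa> x = interval_measure (F x)" for x
  have \<kappa>_prob: "real_distribution (\<kappa> x)" for x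
    unfolding \<kappa>_def by (intro real_distribution_interval_measure Fprops)
  have \<kappa>_Iic: "emeasure (\<kappa> x) {..t} = ennreal (F x t)" for x t
    unfolding \<kappa>_def by (intro emeasure_interval_measure_Iic Fprops)
  have \<kappa>_meas[measurable]: "\<kappa> \<in> S \<rightarrow>\<^sub>M prob_algebra borel"
  proof (rule measurable_prob_algebra_generated[where \<Omega>=UNIV and G="range atMost"])
    show "sets (borel :: real measure) = sigma_sets UNIV (range atMost)"
      by (subst borel_eq_atMost) (rule sets_measure_of, simp)
    show "Int_stable (range atMost :: real set set)" by (auto simp: Int_stable_def)
    show "prob_space (\<kappa> x)" for x using \<kappa>_prob by (rule real_distribution.axioms(1))
    show "(\<lambda>x. emeasure (\<kappa> x) A) \<in> borel_measurable S" if "A \<in> range atMost" for A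
      using that by (auto simp: \<kappa>_Iic)
  qed (auto simp: \<kappa>_def)
  have AE1: "AE x in Q. \<forall>r\<in>\<rat>. G r x = ennreal (H r x)"
  proof (subst AE_ball_countable[OF countable_rat], intro ballI)
    fix r :: real
    show "AE x in Q. G r x = ennreal (H r x)"
    proof (cases "r < 0")
      case True
      then show ?thesis using G0[OF True] by (simp add: H_def)
    next
      case r0: False
      show ?thesis
      proof (cases "1 \<le> r")
        case True
        then show ?thesis using G1[of r] G1'[OF True] r0 by (auto simp: H_def)
      next
        case False
        show ?thesis using G1[of r]
        proof eventually_elim
          case (elim x)
          then have fin: "G r x < top" by (rule le_less_trans) simp
          then have "enn2real (G r x) \<le> 1" using enn2real_mono[OF elim] by simp
          then show ?case using r0 False fin by (simp add: H_def min_absorb2 less_top)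
        qed
      qed
    qed
  qed
  have Iic: "(\<integral>\<^sup>+x\<in>A. emeasure (\<kappa> x) {..t} \<partial>Q) = emeasure P (E A t)" if A[measurable]: "A \<in> sets S" for A t
  proof (rule antisym)
    have "AE x in Q. \<forall>r\<in>{r\<in>\<rat>. t < r}. G t x \<le> G r x"
      by (subst AE_ball_countable) (auto intro: countable_subset[OF _ countable_rat] Gmono)
    then have "AE x in Q. G t x \<le> emeasure (\<kappa> x) {..t}"
      using AE1 G1[of t]
    proof eventually_elim
      case (elim x)
      then have fin: "G t x < top" by (auto intro: le_less_trans)
      have "enn2real (G t x) \<le> F x t"
        unfolding F_def
      proof (rule cINF_greatest)
        show "{r\<in>\<rat>. t < r} \<noteq> {}" using Rats_dense_in_real[of t "t+1"] by auto
        fix r assume "r \<in> {r\<in>\<rat>. t < r}"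
        then have "G t x \<le> ennreal (H r x)" using elim by auto
        then have "enn2real (G t x) \<le> enn2real (ennreal (H r x))" by (rule enn2real_mono) simp
        then show "enn2real (G t x) \<le> H r x" by (simp add: H_def split: if_splits)
      qed
      then have "ennreal (enn2real (G t x)) \<le> ennreal (F x t)" by (rule ennreal_leI)
      then show ?case using fin by (simp add: \<kappa>_Iic)
    qed
    then show "emeasure P (E A t) \<le> (\<integral>\<^sup>+x\<in>A. emeasure (\<kappa> x) {..t} \<partial>Q)"
      unfolding G[OF A, symmetric] by (intro nn_integral_mono_AE) (auto intro!: mult_right_mono)
  next
    have upper: "(\<integral>\<^sup>+x\<in>A. emeasure (\<kappa> x) {..t} \<partial>Q) \<le> emeasure P (E A r)" if r: "r \<in> \<rat>" "t < r" for r
    proof -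
      have FH: "F x t \<le> H r x" for x
        unfolding F_def using r by (intro cINF_lower bdd_belowI[of _ 0]) (auto simp: H_def)
      have "AE x in Q. emeasure (\<kappa> x) {..t} \<le> G r x"
        using AE1
      proof eventually_elim
        case (elim x)
        then show ?case using r FH[of x] by (auto simp: \<kappa>_Iic intro: ennreal_leI)
      qed
      then show ?thesis
        unfolding G[OF A, symmetric] by (intro nn_integral_mono_AE) (auto intro!: mult_right_mono)
    qed
    have lim: "((\<lambda>r. measure P (E A r)) \<longlongrightarrow> measure P (E A t)) (at_right t)"
    proof -
      define D where "D = distr (density P (indicator {\<omega> \<in> space P. X \<omega> \<in> A})) borel h"
      have eD: "emeasure D {..r} = emeasure P (E A r)" for r
        unfolding D_def by (subst emeasure_distr_restricted)
          (auto simp: E_def intro!: arg_cong[where f="emeasure P"])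
      have "emeasure D UNIV = emeasure P ({\<omega> \<in> space P. X \<omega> \<in> A} \<inter> (h -` UNIV \<inter> space P))"
        unfolding D_def by (rule emeasure_distr_restricted) measurable
      then have fD: "emeasure D (space D) \<noteq> \<infinity>" by (simp add: D_def P.emeasure_finite)
      have sD: "sets D = sets borel" by (simp add: D_def)
      interpret D: finite_borel_measure D
        by (intro finite_borel_measure.intro finite_measureI finite_borel_measure_axioms.intro fD sD)
      have "cdf D = (\<lambda>r. measure P (E A r))" by (simp add: fun_eq_iff cdf_def measure_def eD)
      then show ?thesis using D.cdf_is_right_cont[of t] by (simp add: continuous_within)
    qed
    show "(\<integral>\<^sup>+x\<in>A. emeasure (\<kappa> x) {..t} \<partial>Q) \<le> emeasure P (E A t)"
    proof (rule ennreal_le_epsilon)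
      fix e :: real assume "e > 0"
      then have "\<forall>\<^sub>F r in at_right t. measure P (E A r) < measure P (E A t) + e"
        by (intro order_tendstoD(2)[OF lim]) simp
      then obtain b where b: "b > t" "\<And>r. t < r \<Longrightarrow> r < b \<Longrightarrow> measure P (E A r) < measure P (E A t) + e"
        by (auto simp: eventually_at_right_field)
      obtain r where r: "r \<in> \<rat>" "t < r" "r < b" using Rats_dense_in_real[OF b(1)] by blast
      have "emeasure P (E A r) \<le> ennreal (measure P (E A t) + e)"
        unfolding P.emeasure_eq_measure using b(2)[OF r(2,3)] by (intro ennreal_leI) simp
      also have "\<dots> = emeasure P (E A t) + ennreal e"
        using \<open>e > 0\<close> by (simp add: P.emeasure_eq_measure)
      finally show "(\<integral>\<^sup>+x\<in>A. emeasure (\<kappa> x) {..t} \<partial>Q) \<le> emeasure P (E A t) + ennreal e"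
        using upper[OF r(1,2)] by order
    qed
  qed
  show ?thesis
  proof (intro bexI[OF _ \<kappa>_meas] ballI)
    fix A and B :: "real set" assume A[measurable]: "A \<in> sets S" and B[measurable]: "B \<in> sets borel"
    define D where "D = distr (density P (indicator {\<omega> \<in> space P. X \<omega> \<in> A})) borel h"
    define R where "R = density Q (indicator A) \<bind> \<kappa>"
    have eD: "emeasure D C = emeasure P {\<omega> \<in> space P. X \<omega> \<in> A \<and> h \<omega> \<in> C}" if [measurable]: "C \<in> sets borel" for C
      unfolding D_def by (subst emeasure_distr_restricted) (auto intro!: arg_cong[where f="emeasure P"])
    have \<kappa>': "\<kappa> \<in> density Q (indicator A) \<rightarrow>\<^sub>M subprob_algebra borel"
      using measurable_prob_algebraD[OF \<kappa>_meas] by (simp cong: measurable_cong_sets)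
    have eR: "emeasure R C = (\<integral>\<^sup>+x\<in>A. emeasure (\<kappa> x) C \<partial>Q)" if [measurable]: "C \<in> sets borel" for C
      unfolding R_def using \<kappa>' Q.not_empty
      by (subst emeasure_bind[OF _ \<kappa>'])
         (auto simp: nn_integral_density mult.commute measurable_emeasure_kernel[OF measurable_prob_algebraD[OF \<kappa>_meas]] intro!: nn_integral_cong)
    have sets: "sets D = sets borel" "sets R = sets borel"
      unfolding D_def R_def using sets_bind[OF _ _ , of "density Q (indicator A)" \<kappa> borel] \<kappa>' Q.not_empty
      by (auto simp: sets_kernel[OF \<kappa>'])
    have "D = R"
    proof (rule measure_eqI_generator_eq[where \<Omega>=UNIV and E="range atMost" and A="\<lambda>n::nat. {..real n}"])
      show "Int_stable (range atMost :: real set set)" by (auto simp: Int_stable_def)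
      show "sets D = sigma_sets UNIV (range atMost)" "sets R = sigma_sets UNIV (range atMost)"
        unfolding sets by (subst borel_eq_atMost, rule sets_measure_of, simp)+
      show "emeasure D C = emeasure R C" if "C \<in> range atMost" for C
        using that by (auto simp: eD eR Iic E_def)
      show "(\<Union>n. {..real n}) = UNIV" using real_arch_simple by auto
      show "emeasure D {..real n} \<noteq> \<infinity>" for n by (simp add: eD P.emeasure_finite)
    qed auto
    then show "emeasure P {\<omega> \<in> space P. X \<omega> \<in> A \<and> h \<omega> \<in> B} = (\<integral>\<^sup>+x\<in>A. emeasure (\<kappa> x) B \<partial>distr P S X)"
      using eD[OF B] eR[OF B] by (simp add: Q_def)
  qed
qed

text \<open>The conditional law of the real code of the second coordinate, pushed back by the decoding
  map \<open>g\<close>. As \<open>g\<close> is defined on the whole line, the image is a probability measure even where the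
  conditional law charges reals that code nothing.\<close>
lemma disintegration_exists:
  fixes P :: "('a::metric_space \<times> 'b::metric_space) measure"
  assumes "compact (UNIV :: 'a set)" and Y: "compact (UNIV :: 'b set)" and P: "P \<in> borel_probs"
  shows "is_disintegration P (disintegration P)"
proof -
  have sP[simp]: "sets P = sets borel" and "prob_space P" using P by (auto simp: borel_probs_def)
  have spP[simp]: "space P = UNIV" using sets_eq_imp_space_eq[OF sP] by simp
  obtain h :: "'b \<Rightarrow> real" and g :: "real \<Rightarrow> 'b"
    where h[measurable]: "h \<in> borel_measurable borel" and g[measurable]: "g \<in> borel_measurable borel"
      and gh: "\<And>y. g (h y) = y" and h01: "\<And>y. 0 \<le> h y \<and> h y < 1"
    by (rule compact_metric_real_coding[OF Y]) (rule that)
  have fst_snd[measurable]: "fst \<in> P \<rightarrow>\<^sub>M borel" "snd \<in> P \<rightarrow>\<^sub>M borel"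
    unfolding measurable_cong_sets[OF sP refl]
    by (auto intro!: borel_measurable_continuous_onI continuous_intros)
  have hm: "(\<lambda>z. h (snd z)) \<in> borel_measurable P" by (rule measurable_compose[OF fst_snd(2) h])
  have "\<exists>\<kappa>\<in>borel \<rightarrow>\<^sub>M prob_algebra borel. \<forall>A\<in>sets borel. \<forall>B\<in>sets borel.
       emeasure P {z \<in> space P. fst z \<in> A \<and> h (snd z) \<in> B} = (\<integral>\<^sup>+x\<in>A. emeasure (\<kappa> x) B \<partial>distr P borel fst)"
    by (rule real_conditional_distribution[OF \<open>prob_space P\<close> fst_snd(1) hm h01])
  then obtain \<kappa> where \<kappa>: "\<kappa> \<in> borel \<rightarrow>\<^sub>M prob_algebra borel"
    "\<forall>A\<in>sets borel. \<forall>B\<in>sets borel.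
       emeasure P {z \<in> space P. fst z \<in> A \<and> h (snd z) \<in> B} = (\<integral>\<^sup>+x\<in>A. emeasure (\<kappa> x) B \<partial>distr P borel fst)"
    by (rule bexE)
  have sets_\<kappa>: "sets (\<kappa> x) = sets borel" for x
    using measurable_space[OF \<kappa>(1), of x] by (simp add: space_prob_algebra)
  have sp_\<kappa>: "space (\<kappa> x) = UNIV" for x using sets_eq_imp_space_eq[OF sets_\<kappa>] by simp
  have "is_disintegration P (\<lambda>x. distr (\<kappa> x) borel g)"
    unfolding is_disintegration_def
  proof (intro conjI ballI)
    show "(\<lambda>x. distr (\<kappa> x) borel g) \<in> borel \<rightarrow>\<^sub>M prob_algebra borel"
      using measurable_compose[OF \<kappa>(1) measurable_distr_prob_space[OF g]] .
    fix A :: "'a set" and B :: "'b set" assume A: "A \<in> sets borel" and B: "B \<in> sets borel"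
    have gB: "g -` B \<in> sets borel" using measurable_sets[OF g B] by simp
    have "A \<times> B = {z \<in> space P. fst z \<in> A \<and> h (snd z) \<in> g -` B}" by (auto simp: gh)
    then show "emeasure P (A \<times> B) = (\<integral>\<^sup>+x\<in>A. emeasure (distr (\<kappa> x) borel g) B \<partial>marginal1 P)"
      using \<kappa>(2)[rule_format, OF A gB] B
      by (simp add: marginal1_def emeasure_distr sp_\<kappa> measurable_cong_sets[OF sets_\<kappa> refl])
  qed
  then show ?thesis unfolding disintegration_def by (rule someI[where P="is_disintegration P"])
qed

lemma is_disintegration_prob:
  assumes "is_disintegration P K"
  shows "prob_space (K x)" "sets (K x) = sets borel" "space (K x) = UNIV"
proof -
  have "K x \<in> space (prob_algebra borel)"
    using assms measurable_space[of K borel "prob_algebra borel" x] by (auto simp: is_disintegration_def)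
  then show "prob_space (K x)" and s: "sets (K x) = sets borel" by (auto simp: space_prob_algebra)
  show "space (K x) = UNIV" using sets_eq_imp_space_eq[OF s] by simp
qed

lemma sets_marginal1[simp]: "sets (marginal1 P) = sets borel" by (simp add: marginal1_def)
lemma space_marginal1[simp]: "space (marginal1 P) = UNIV" by (simp add: marginal1_def)

lemma marginal1_borel_probs:
  assumes "P \<in> borel_probs"
  shows "marginal1 P \<in> borel_probs"
  using assms unfolding borel_probs_def marginal1_def
  by (auto intro!: prob_space.prob_space_distr simp: measurable_cong_sets[of P borel]
      borel_measurable_continuous_onI continuous_intros)

text \<open>The plan is the composition of its first marginal with the kernels \<open>K x\<close> placed on the fibre over
  \<open>x\<close>: both measures agree on rectangles, which generate the Borel sets of the product.\<close>
lemma integral_disintegration: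
  fixes P :: "('a::metric_space \<times> 'b::metric_space) measure"
  assumes X: "compact (UNIV :: 'a set)" and Y: "compact (UNIV :: 'b set)" and P: "P \<in> borel_probs"
    and K: "is_disintegration P K"
    and f: "f \<in> borel_measurable borel" and C: "\<And>z. \<bar>f z :: real\<bar> \<le> C"
  shows "(\<lambda>x. \<integral>y. f (x, y) \<partial>K x) \<in> borel_measurable borel"
    and "integral\<^sup>L P f = (\<integral>x. \<integral>y. f (x, y) \<partial>K x \<partial>marginal1 P)"
    and "\<bar>\<integral>y. f (x, y) \<partial>K x\<bar> \<le> C"
proof -
  note sets_prod = sets_borel_prod_compact[OF X Y]
  have sP[simp]: "sets P = sets borel" and "prob_space P" using P by (auto simp: borel_probs_def)
  interpret P: prob_space P by fact
  interpret P1: prob_space "marginal1 P" using marginal1_borel_probs[OF P] by (simp add: borel_probs_def)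
  have Km: "K \<in> borel \<rightarrow>\<^sub>M prob_algebra borel" using K by (simp add: is_disintegration_def)
  have f': "f \<in> borel_measurable (borel \<Otimes>\<^sub>M borel)" using f by (simp add: measurable_cong_sets[OF sets_prod refl])
  define L where "L x = distr (K x) (borel \<Otimes>\<^sub>M borel) (Pair x)" for x
  have L: "L \<in> borel \<rightarrow>\<^sub>M prob_algebra (borel \<Otimes>\<^sub>M borel)"
    unfolding L_def by (rule measurable_distr_prob_space2[OF Km]) simp
  have L': "L \<in> marginal1 P \<rightarrow>\<^sub>M subprob_algebra (borel \<Otimes>\<^sub>M borel)"
    using measurable_prob_algebraD[OF L] by (simp cong: measurable_cong_sets)
  have PairK: "Pair x \<in> K x \<rightarrow>\<^sub>M borel \<Otimes>\<^sub>M borel" for x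
    unfolding measurable_cong_sets[OF is_disintegration_prob(2)[OF K] refl] by simp
  have iL: "integral\<^sup>L (L x) f = (\<integral>y. f (x, y) \<partial>K x)" for x
    unfolding L_def by (rule integral_distr[OF PairK f'])
  have "(\<lambda>x. integral\<^sup>L (L x) f) \<in> borel_measurable borel"
    using measurable_compose[OF measurable_prob_algebraD[OF L] integral_measurable_subprob_algebra[OF f']] .
  then show "(\<lambda>x. \<integral>y. f (x, y) \<partial>K x) \<in> borel_measurable borel" by (simp add: iL)
  have "P = marginal1 P \<bind> L"
  proof (rule measure_eqI_generator_eq[where \<Omega>=UNIV and E="{A \<times> B | A B. A \<in> sets borel \<and> B \<in> sets borel}" and A="\<lambda>_. UNIV"])
    show "Int_stable {A \<times> B | (A::'a set) (B::'b set). A \<in> sets borel \<and> B \<in> sets borel}"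
      using Int_stable_pair_measure_generator[of borel borel] by simp
    show gen: "sets P = sigma_sets UNIV {A \<times> B | A B. A \<in> sets borel \<and> B \<in> sets borel}"
      unfolding sP sets_prod[symmetric] by (simp add: sets_pair_measure)
    show "sets (marginal1 P \<bind> L) = sigma_sets UNIV {A \<times> B | A B. A \<in> sets borel \<and> B \<in> sets borel}"
      by (subst sets_bind[OF sets_kernel[OF L']]) (auto simp: sets_pair_measure)
    fix R assume "R \<in> {A \<times> B | (A::'a set) (B::'b set). A \<in> sets borel \<and> B \<in> sets borel}"
    then obtain A B where R: "R = A \<times> B" and A: "A \<in> sets borel" and B: "B \<in> sets borel" by blast
    have AB: "A \<times> B \<in> sets (borel \<Otimes>\<^sub>M borel)" using A B by simp
    have "emeasure (L x) (A \<times> B) = emeasure (K x) B * indicator A x" for x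
    proof -
      have "emeasure (L x) (A \<times> B) = emeasure (K x) (Pair x -` (A \<times> B) \<inter> space (K x))"
        unfolding L_def by (rule emeasure_distr[OF PairK AB])
      also have "Pair x -` (A \<times> B) \<inter> space (K x) = (if x \<in> A then B else {})"
        by (auto simp: is_disintegration_prob[OF K])
      finally show ?thesis by simp
    qed
    then have "emeasure (marginal1 P \<bind> L) (A \<times> B) = (\<integral>\<^sup>+x\<in>A. emeasure (K x) B \<partial>marginal1 P)"
      using emeasure_bind[OF _ L' AB] by simp
    then show "emeasure P R = emeasure (marginal1 P \<bind> L) R"
      using K A B by (simp add: is_disintegration_def R)
  qed (auto intro!: exI[of _ UNIV])
  then have "integral\<^sup>L P f = integral\<^sup>L (marginal1 P \<bind> L) f" by simp
  also have "\<dots> = (\<integral>x. integral\<^sup>L (L x) f \<partial>marginal1 P)"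
  proof (rule integral_bind[OF f' _ L' P1.finite_measure_axioms, where B=C and B'=1])
    show "AE x in marginal1 P. emeasure (L x) (space (L x)) \<le> ennreal 1"
      using measurable_space[OF L] by (auto simp: space_prob_algebra prob_space.emeasure_space_1)
  qed (use C in simp)
  finally show "integral\<^sup>L P f = (\<integral>x. \<integral>y. f (x, y) \<partial>K x \<partial>marginal1 P)" by (simp add: iL)
  interpret Kx: prob_space "K x" by (rule is_disintegration_prob[OF K])
  have "integrable (K x) (\<lambda>y. f (x, y))"
    using C measurable_compose[OF PairK f'] by (intro Kx.integrable_const_bound[where B=C]) auto
  then have "\<bar>\<integral>y. f (x, y) \<partial>K x\<bar> \<le> (\<integral>y. C \<partial>K x)"
    using C by (intro order_trans[OF integral_abs_bound] integral_mono) auto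
  then show "\<bar>\<integral>y. f (x, y) \<partial>K x\<bar> \<le> C" by (simp add: Kx.prob_space)
qed

lemma integral_scale_measure:
  fixes f :: "'a \<Rightarrow> real"
  assumes f: "f \<in> borel_measurable M" and r: "0 \<le> r"
  shows "integral\<^sup>L (scale_measure (ennreal r) M) f = r * integral\<^sup>L M f"
proof -
  have "scale_measure (ennreal r) M = density M (\<lambda>_. ennreal r)"
    by (rule measure_eqI) (auto simp: emeasure_density nn_integral_cmult_indicator)
  then show ?thesis using integral_density[OF f, of "\<lambda>_. r"] r by simp
qed

section \<open>Bounds for extended integrals\<close>

text \<open>The function \<open>g\<close> is arbitrary here because it stands for the integrand of a plan cost, which is
  determined only almost everywhere and need not be Borel.\<close>
lemma ext_integral_ge:
  assumes u: "integrable M u" and le: "AE x in M. u x \<le> g x"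
  shows "ereal (integral\<^sup>L M u) \<le> ext_integral M g"
proof -
  obtain r q where rq: "0 \<le> r" "0 \<le> q" "(\<integral>\<^sup>+x. ennreal (u x) \<partial>M) = ennreal r"
    "(\<integral>\<^sup>+x. ennreal (- u x) \<partial>M) = ennreal q" "integral\<^sup>L M u = r - q"
    using integrableE[OF u] by metis
  have "(\<integral>\<^sup>+x. ennreal (u x) \<partial>M) \<le> (\<integral>\<^sup>+x. ennreal (g x) \<partial>M)"
    using le by (intro nn_integral_mono_AE) (auto intro: ennreal_leI)
  moreover have "(\<integral>\<^sup>+x. ennreal (- g x) \<partial>M) \<le> (\<integral>\<^sup>+x. ennreal (- u x) \<partial>M)"
    using le by (intro nn_integral_mono_AE) (auto elim!: eventually_mono intro!: ennreal_leI)
  ultimately have "enn2ereal (ennreal r) - enn2ereal (ennreal q) \<le> ext_integral M g"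
    unfolding ext_integral_def rq by (intro ereal_minus_mono) (auto simp: less_eq_ennreal.rep_eq)
  then show ?thesis using rq by (simp add: enn2ereal_ennreal)
qed

lemma ext_integral_le_of_incseq:
  fixes w :: "nat \<Rightarrow> 'a \<Rightarrow> real"
  assumes w: "\<And>n. integrable M (w n)" and mono: "\<And>x. incseq (\<lambda>n. w n x)"
    and lim: "AE x in M. (\<lambda>n. w n x) \<longlonglongrightarrow> g x" and J: "\<And>n. integral\<^sup>L M (w n) \<le> J"
  shows "ext_integral M g \<le> ereal J"
proof -
  define g' where "g' x = lim (\<lambda>n. w n x)" for x
  have g'_meas: "g' \<in> borel_measurable M"
    unfolding g'_def using w by (intro borel_measurable_lim_metric) auto
  have g': "AE x in M. g x = g' x" using lim by eventually_elim (simp add: g'_def limI)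
  have "incseq (\<lambda>n. integral\<^sup>L M (w n))"
    using mono w by (intro incseq_SucI integral_mono) (auto simp: incseq_Suc_iff)
  then obtain L where L: "(\<lambda>n. integral\<^sup>L M (w n)) \<longlonglongrightarrow> L"
    using incseq_convergent J by metis
  have LJ: "L \<le> J" using J by (intro LIMSEQ_le_const2[OF L]) auto
  have "AE x in M. (\<lambda>n. w n x) \<longlonglongrightarrow> g' x" using lim g' by eventually_elim simp
  then have i: "integrable M g'" "integral\<^sup>L M g' = L"
    using mono by (auto intro: integral_monotone_convergence[OF w _ _ L g'_meas] integrable_monotone_convergence[OF w _ _ L g'_meas])
  obtain r q where rq: "0 \<le> r" "0 \<le> q" "(\<integral>\<^sup>+x. ennreal (g' x) \<partial>M) = ennreal r"
    "(\<integral>\<^sup>+x. ennreal (- g' x) \<partial>M) = ennreal q" "integral\<^sup>L M g' = r - q"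
    using integrableE[OF i(1)] by metis
  have "(\<integral>\<^sup>+x. ennreal (g x) \<partial>M) = ennreal r" "(\<integral>\<^sup>+x. ennreal (- g x) \<partial>M) = ennreal q"
    unfolding rq(3,4)[symmetric] using g' by (auto intro!: nn_integral_cong_AE)
  then have "ext_integral M g = ereal (r - q)"
    using rq(1,2) by (simp add: ext_integral_def enn2ereal_ennreal)
  then show ?thesis using rq i LJ by simp
qed

section \<open>Affine minorants of the cost\<close>
definition affine_minorant ::
  "('a::topological_space \<Rightarrow> 'b::topological_space measure \<Rightarrow> real) \<Rightarrow> ('a \<times> 'b \<Rightarrow> real) \<Rightarrow> ('a \<Rightarrow> real) \<Rightarrow> bool" where
  "affine_minorant c b a \<longleftrightarrow> continuous_on UNIV b \<and> continuous_on UNIV a \<and>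
     (\<forall>x. \<forall>m\<in>borel_finite_measures. (\<integral>y. b (x, y) \<partial>m) + a x \<le> c x m)"

lemma continuous_on_compact_bounded:
  fixes f :: "'a::topological_space \<Rightarrow> real"
  assumes "compact (UNIV :: 'a set)" and "continuous_on UNIV f"
  shows "\<exists>C\<ge>0. \<forall>x. \<bar>f x\<bar> \<le> C"
proof -
  obtain C where "0 < C" "\<forall>y\<in>range f. norm y \<le> C"
    using compact_imp_bounded[OF compact_continuous_image[OF assms(2,1)]] unfolding bounded_pos by blast
  then show ?thesis by (intro exI[of _ C]) simp
qed

lemma continuous_family_bounded:
  fixes f :: "nat \<Rightarrow> 'a::topological_space \<Rightarrow> real"
  assumes "compact (UNIV :: 'a set)" and "\<And>k. continuous_on UNIV (f k)"
  shows "\<exists>C\<ge>0. \<forall>k\<le>n. \<forall>x. \<bar>f k x\<bar> \<le> C"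
proof -
  have "\<forall>k. \<exists>C\<ge>0. \<forall>x. \<bar>f k x\<bar> \<le> C" using continuous_on_compact_bounded[OF assms] by blast
  then obtain C where C: "\<And>k. 0 \<le> C k" "\<And>k x. \<bar>f k x\<bar> \<le> C k" by metis
  have "\<bar>f k x\<bar> \<le> (\<Sum>k\<le>n. C k)" if "k \<le> n" for k x
    using C(2)[of k x] member_le_sum[of k "{..n}" C] C(1) that by force
  then show ?thesis using C(1) by (intro exI[of _ "\<Sum>k\<le>n. C k"]) (auto intro: sum_nonneg)
qed

text \<open>Taking the least maximiser makes the choice measurable.\<close>
definition argmax_upto :: "(nat \<Rightarrow> 'a \<Rightarrow> real) \<Rightarrow> nat \<Rightarrow> 'a \<Rightarrow> nat" where
  "argmax_upto u n x = (LEAST k. k \<le> n \<and> (\<forall>j\<le>n. u j x \<le> u k x))"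

lemma argmax_upto: "argmax_upto u n x \<le> n" "j \<le> n \<Longrightarrow> u j x \<le> u (argmax_upto u n x) x"
proof -
  define m where "m = Max ((\<lambda>k. u k x) ` {..n})"
  have "m \<in> (\<lambda>k. u k x) ` {..n}" unfolding m_def by (intro Max_in) auto
  then obtain k where k: "k \<le> n" "u k x = m" by auto
  have "u j x \<le> m" if "j \<le> n" for j unfolding m_def using that by (intro Max_ge) auto
  then have "k \<le> n \<and> (\<forall>j\<le>n. u j x \<le> u k x)" using k by auto
  then have "argmax_upto u n x \<le> n \<and> (\<forall>j\<le>n. u j x \<le> u (argmax_upto u n x) x)"
    unfolding argmax_upto_def by (rule LeastI)
  then show "argmax_upto u n x \<le> n" "j \<le> n \<Longrightarrow> u j x \<le> u (argmax_upto u n x) x" by auto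
qed

lemma argmax_upto_measurable[measurable]:
  assumes [measurable]: "\<And>k. u k \<in> borel_measurable M"
  shows "argmax_upto u n \<in> M \<rightarrow>\<^sub>M count_space UNIV"
  unfolding argmax_upto_def by measurable

text \<open>The plan \<open>P\<close> below is only a probability measure on the product. Nothing relates its first marginal
  to \<open>\<mu>\<close>, since for a weak solution the absolute continuity has to be proved.\<close>
locale compact_plan =
  fixes \<mu> :: "'a::metric_space measure" and P :: "('a \<times> 'b::metric_space) measure"
  assumes compact_X: "compact (UNIV :: 'a set)" and compact_Y: "compact (UNIV :: 'b set)"
    and \<mu>: "\<mu> \<in> borel_probs" and P: "P \<in> borel_probs"
begin

sublocale \<mu>: prob_space \<mu> using \<mu> by (simp add: borel_probs_def)
sublocale P: prob_space P using P by (simp add: borel_probs_def)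
sublocale P1: prob_space "marginal1 P" using marginal1_borel_probs[OF P] by (simp add: borel_probs_def)

lemma sets_\<mu>[simp, measurable_cong]: "sets \<mu> = sets borel" using \<mu> by (simp add: borel_probs_def)
lemma sets_P[simp, measurable_cong]: "sets P = sets borel" using P by (simp add: borel_probs_def)

lemma compact_XY: "compact (UNIV :: ('a \<times> 'b) set)"
  using compact_Times[OF compact_X compact_Y] by simp

lemma fst_borel[measurable]: "fst \<in> (borel :: ('a \<times> 'b) measure) \<rightarrow>\<^sub>M borel"
  by (intro borel_measurable_continuous_onI continuous_intros)

abbreviation K where "K \<equiv> disintegration P"

lemma K: "is_disintegration P K"
  by (rule disintegration_exists[OF compact_X compact_Y P])

definition cond_mean :: "('a \<times> 'b \<Rightarrow> real) \<Rightarrow> 'a \<Rightarrow> real" where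
  "cond_mean f x = (\<integral>y. f (x, y) \<partial>K x)"

lemma cond_mean:
  assumes "f \<in> borel_measurable borel" "\<And>z. \<bar>f z\<bar> \<le> C"
  shows "cond_mean f \<in> borel_measurable borel" "integral\<^sup>L P f = integral\<^sup>L (marginal1 P) (cond_mean f)"
    "\<bar>cond_mean f x\<bar> \<le> C"
  using integral_disintegration[OF compact_X compact_Y P K assms] by (simp_all add: cond_mean_def[abs_def])

definition dens :: "'a \<Rightarrow> real" where "dens x = enn2real (RN_deriv \<mu> (marginal1 P) x)"

lemma dens_nonneg[simp]: "0 \<le> dens x" by (simp add: dens_def)

lemma dens_measurable[measurable]: "dens \<in> borel_measurable borel"
  using borel_measurable_RN_deriv[of \<mu> "marginal1 P"] unfolding dens_def
  by (simp add: measurable_cong_sets[OF sets_\<mu> refl])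

lemma AE_dens:
  assumes "absolutely_continuous \<mu> (marginal1 P)"
  shows "AE x in \<mu>. RN_deriv \<mu> (marginal1 P) x = ennreal (dens x)"
proof -
  have "AE x in \<mu>. RN_deriv \<mu> (marginal1 P) x \<noteq> \<infinity>"
    by (rule \<mu>.RN_deriv_finite[OF P1.sigma_finite_measure_axioms assms]) simp
  then show ?thesis by eventually_elim (simp add: dens_def less_top)
qed

lemma marginal1_eq_density:
  assumes ac: "absolutely_continuous \<mu> (marginal1 P)"
  shows "marginal1 P = density \<mu> (\<lambda>x. ennreal (dens x))"
proof -
  have "marginal1 P = density \<mu> (RN_deriv \<mu> (marginal1 P))"
    by (rule \<mu>.density_RN_deriv[OF ac, symmetric]) simp
  also have "\<dots> = density \<mu> (\<lambda>x. ennreal (dens x))"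
    using AE_dens[OF ac] by (intro density_cong) (auto simp: measurable_cong_sets[OF sets_\<mu> refl])
  finally show ?thesis .
qed

lemma dens_integral:
  assumes ac: "absolutely_continuous \<mu> (marginal1 P)" and g[measurable]: "g \<in> borel_measurable borel" and C: "\<And>x. \<bar>g x\<bar> \<le> C"
  shows "integrable \<mu> (\<lambda>x. dens x * g x)" "(\<integral>x. dens x * g x \<partial>\<mu>) = integral\<^sup>L (marginal1 P) g"
proof -
  have m: "g \<in> borel_measurable \<mu>" "dens \<in> borel_measurable \<mu>" by measurable
  have "integrable (marginal1 P) g"
    using C by (intro P1.integrable_const_bound[where B=C]) (auto simp: measurable_cong_sets[OF sets_marginal1 refl])
  then show "integrable \<mu> (\<lambda>x. dens x * g x)"
    unfolding marginal1_eq_density[OF ac] by (subst (asm) integrable_density[OF m]) auto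
  show "(\<integral>x. dens x * g x \<partial>\<mu>) = integral\<^sup>L (marginal1 P) g"
    by (subst marginal1_eq_density[OF ac], subst integral_density[OF m]) auto
qed

lemma scaled_kernel:
  assumes "0 \<le> r"
  shows "scale_measure (ennreal r) (K x) \<in> borel_finite_measures"
    and "continuous_on UNIV f \<Longrightarrow> (\<integral>y. f (x, y) \<partial>scale_measure (ennreal r) (K x)) = r * cond_mean f x"
proof -
  note Kx = is_disintegration_prob[OF K, of x]
  interpret Kx: prob_space "K x" by (rule Kx)
  show "scale_measure (ennreal r) (K x) \<in> borel_finite_measures"
    using Kx.finite_measure_axioms unfolding borel_finite_measures_def
    by (auto simp: Kx space_scale_measure Kx.emeasure_space_1[simplified Kx] intro!: finite_measureI)
  assume f: "continuous_on UNIV f"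
  have "(\<lambda>y. f (x, y)) \<in> borel_measurable (K x)"
    unfolding measurable_cong_sets[OF Kx(2) refl]
    by (intro borel_measurable_continuous_onI continuous_on_compose2[OF f] continuous_intros) auto
  then show "(\<integral>y. f (x, y) \<partial>scale_measure (ennreal r) (K x)) = r * cond_mean f x"
    unfolding cond_mean_def by (rule integral_scale_measure[OF _ assms])
qed

text \<open>Inserting the density times the kernel into the minorant inequality and integrating against \<open>\<mu>\<close>
  recovers the integral of \<open>b\<close> against the plan.\<close>
lemma affine_minorant_le_plan_cost:
  fixes c :: "'a \<Rightarrow> 'b measure \<Rightarrow> real"
  assumes ac: "absolutely_continuous \<mu> (marginal1 P)" and ba: "affine_minorant c b a"
  shows "ereal (integral\<^sup>L P b + integral\<^sup>L \<mu> a) \<le> plan_cost c \<mu> P"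
proof -
  have cont: "continuous_on UNIV b" "continuous_on UNIV a"
    and le: "\<And>x m. m \<in> borel_finite_measures \<Longrightarrow> (\<integral>y. b (x, y) \<partial>m) + a x \<le> c x m"
    using ba by (auto simp: affine_minorant_def)
  have [measurable]: "b \<in> borel_measurable borel" "a \<in> borel_measurable borel"
    using cont by (auto intro: borel_measurable_continuous_onI)
  obtain B where B: "\<And>z. \<bar>b z\<bar> \<le> B" using continuous_on_compact_bounded[OF compact_XY cont(1)] by blast
  obtain A where A: "\<And>x. \<bar>a x\<bar> \<le> A" using continuous_on_compact_bounded[OF compact_X cont(2)] by blast
  note cm = cond_mean[of b B, OF _ B, simplified]
  have i: "integrable \<mu> (\<lambda>x. dens x * cond_mean b x)" "integrable \<mu> a"
    using dens_integral(1)[OF ac cm(1,3)] A by (simp, intro \<mu>.integrable_const_bound[where B=A]) auto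
  have "AE x in \<mu>. dens x * cond_mean b x + a x \<le> c x (scale_measure (RN_deriv \<mu> (marginal1 P) x) (K x))"
    using AE_dens[OF ac]
  proof eventually_elim
    case (elim x)
    have "scale_measure (ennreal (dens x)) (K x) \<in> borel_finite_measures" by (rule scaled_kernel(1)) simp
    from le[OF this, of x] show ?case unfolding elim scaled_kernel(2)[OF dens_nonneg cont(1)] .
  qed
  then have "ereal (\<integral>x. dens x * cond_mean b x + a x \<partial>\<mu>) \<le> plan_cost c \<mu> P"
    unfolding plan_cost_def using i by (intro ext_integral_ge) auto
  also have "(\<integral>x. dens x * cond_mean b x + a x \<partial>\<mu>) = integral\<^sup>L P b + integral\<^sup>L \<mu> a"
    using i cm dens_integral(2)[OF ac cm(1) cm(3)] by simp
  finally show ?thesis .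
qed

text \<open>The weight depends on \<open>x\<close> alone and the cost at \<open>(x, m)\<close> involves a single \<open>x\<close>, so a blend is a
  convex combination of two lower bounds of the same number.\<close>
lemma affine_minorant_blend:
  fixes c :: "'a \<Rightarrow> 'b measure \<Rightarrow> real"
  assumes 1: "affine_minorant c b a" and 2: "affine_minorant c b' a'"
    and \<theta>: "continuous_on UNIV \<theta>" "\<And>x. 0 \<le> \<theta> x \<and> \<theta> x \<le> (1 :: real)"
  shows "affine_minorant c (\<lambda>z. (1 - \<theta> (fst z)) * b z + \<theta> (fst z) * b' z) (\<lambda>x. (1 - \<theta> x) * a x + \<theta> x * a' x)"
  unfolding affine_minorant_def
proof (intro conjI allI ballI)
  have cont: "continuous_on UNIV b" "continuous_on UNIV a" "continuous_on UNIV b'" "continuous_on UNIV a'"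
    using 1 2 by (auto simp: affine_minorant_def)
  have \<theta>fst: "continuous_on UNIV (\<lambda>z. \<theta> (fst z))"
    by (intro continuous_on_compose2[OF \<theta>(1)] continuous_intros) auto
  show "continuous_on UNIV (\<lambda>z. (1 - \<theta> (fst z)) * b z + \<theta> (fst z) * b' z)"
    using cont \<theta>fst by (intro continuous_intros)
  show "continuous_on UNIV (\<lambda>x. (1 - \<theta> x) * a x + \<theta> x * a' x)"
    using cont \<theta>(1) by (intro continuous_intros)
  fix x :: 'a and m :: "'b measure" assume m: "m \<in> borel_finite_measures"
  then have sm: "sets m = sets borel" and "finite_measure m" by (auto simp: borel_finite_measures_def)
  interpret m: finite_measure m by fact
  have int: "integrable m (\<lambda>y. f (x, y))" if f: "continuous_on UNIV f" for f :: "'a \<times> 'b \<Rightarrow> real"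
  proof -
    obtain C where C: "\<And>z. \<bar>f z\<bar> \<le> C" using continuous_on_compact_bounded[OF compact_XY f] by blast
    have "(\<lambda>y. f (x, y)) \<in> borel_measurable m"
      unfolding measurable_cong_sets[OF sm refl]
      by (intro borel_measurable_continuous_onI continuous_on_compose2[OF f] continuous_intros) auto
    then show ?thesis using C by (intro m.integrable_const_bound[where B=C]) auto
  qed
  have "(\<integral>y. (1 - \<theta> (fst (x, y))) * b (x, y) + \<theta> (fst (x, y)) * b' (x, y) \<partial>m) + ((1 - \<theta> x) * a x + \<theta> x * a' x)
      = (1 - \<theta> x) * ((\<integral>y. b (x, y) \<partial>m) + a x) + \<theta> x * ((\<integral>y. b' (x, y) \<partial>m) + a' x)"
    using int[OF cont(1)] int[OF cont(3)] by (simp add: algebra_simps)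
  also have "\<dots> \<le> (1 - \<theta> x) * c x m + \<theta> x * c x m"
    using 1 2 m \<theta>(2)[of x] by (intro add_mono mult_left_mono) (auto simp: affine_minorant_def)
  finally show "(\<integral>y. (1 - \<theta> (fst (x, y))) * b (x, y) + \<theta> (fst (x, y)) * b' (x, y) \<partial>m) + ((1 - \<theta> x) * a x + \<theta> x * a' x) \<le> c x m"
    by (simp add: algebra_simps)
qed

lemma selection_measurable:
  assumes "\<And>k::nat. continuous_on UNIV (f k :: 'a \<times> 'b \<Rightarrow> real)" "\<And>k. continuous_on UNIV (g k :: 'a \<Rightarrow> real)"
    and \<kappa>[measurable]: "\<kappa> \<in> borel \<rightarrow>\<^sub>M count_space UNIV"
  shows "(\<lambda>z. f (\<kappa> (fst z)) z) \<in> borel_measurable borel" "(\<lambda>x. g (\<kappa> x) x) \<in> borel_measurable borel"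
  by (rule measurable_compose_countable[where f=f], simp_all add: assms borel_measurable_continuous_onI)
    (rule measurable_compose_countable[where f=g], simp_all add: assms borel_measurable_continuous_onI)

text \<open>Induction on the largest index: on the Borel set where \<open>\<kappa> = Suc n\<close> the minorant with that index
  is blended in with a continuous weight close to the indicator of this set.\<close>
lemma selection_approx:
  fixes c :: "'a \<Rightarrow> 'b measure \<Rightarrow> real" and b :: "nat \<Rightarrow> 'a \<times> 'b \<Rightarrow> real" and a :: "nat \<Rightarrow> 'a \<Rightarrow> real"
  assumes minor: "\<And>k. affine_minorant c (b k) (a k)"
    and "\<kappa> \<in> borel \<rightarrow>\<^sub>M count_space UNIV" "\<And>x. \<kappa> x \<le> n" "e > 0"
  shows "\<exists>b' a'. affine_minorant c b' a' \<and> (\<integral>z. \<bar>b' z - b (\<kappa> (fst z)) z\<bar> \<partial>P) < e \<and> (\<integral>x. \<bar>a' x - a (\<kappa> x) x\<bar> \<partial>\<mu>) < e"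
  using assms(2-)
proof (induction n arbitrary: \<kappa> e)
  case 0
  then show ?case using minor[of 0] by (intro exI[of _ "b 0"] exI[of _ "a 0"]) simp
next
  case (Suc n)
  note \<kappa>[measurable] = Suc.prems(1)
  have cont: "continuous_on UNIV (b k)" "continuous_on UNIV (a k)" for k
    using minor by (auto simp: affine_minorant_def)
  define \<kappa>' where "\<kappa>' x = min n (\<kappa> x)" for x
  have \<kappa>'[measurable]: "\<kappa>' \<in> borel \<rightarrow>\<^sub>M count_space UNIV" unfolding \<kappa>'_def by measurable
  define B where "B = {x. \<kappa> x = Suc n}"
  have B[measurable]: "B \<in> sets borel" unfolding B_def by measurable
  have \<kappa>_cases: "\<kappa> x = (if x \<in> B then Suc n else \<kappa>' x)" for x
    using Suc.prems(2)[of x] by (auto simp: B_def \<kappa>'_def)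
  obtain b1 a1 where 1: "affine_minorant c b1 a1" "(\<integral>z. \<bar>b1 z - b (\<kappa>' (fst z)) z\<bar> \<partial>P) < e / 2"
    "(\<integral>x. \<bar>a1 x - a (\<kappa>' x) x\<bar> \<partial>\<mu>) < e / 2"
    using Suc.IH[OF \<kappa>', of "e / 2"] Suc.prems(3) by (auto simp: \<kappa>'_def)
  have cont1: "continuous_on UNIV b1" "continuous_on UNIV a1" using 1 by (auto simp: affine_minorant_def)
  obtain C1 where C1: "0 \<le> C1" "\<And>z. \<bar>b1 z - b (Suc n) z\<bar> \<le> C1"
    using continuous_on_compact_bounded[OF compact_XY continuous_on_diff[OF cont1(1) cont(1)[of "Suc n"]]] by blast
  obtain C2 where C2: "0 \<le> C2" "\<And>x. \<bar>a1 x - a (Suc n) x\<bar> \<le> C2"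
    using continuous_on_compact_bounded[OF compact_X continuous_on_diff[OF cont1(2) cont(2)[of "Suc n"]]] by blast
  define C where "C = C1 + C2 + 1"
  have C: "C > 0" "\<bar>b1 z - b (Suc n) z\<bar> \<le> C" "\<bar>a1 x - a (Suc n) x\<bar> \<le> C" for z x
    using C1(1) C1(2)[of z] C2(1) C2(2)[of x] by (auto simp: C_def)
  have fin: "{marginal1 P, \<mu>} \<subseteq> borel_finite_measures"
    by (auto simp: borel_finite_measures_def P1.finite_measure_axioms \<mu>.finite_measure_axioms)
  obtain \<theta> where \<theta>: "continuous_on UNIV \<theta>" "\<And>x. 0 \<le> \<theta> x \<and> \<theta> x \<le> 1"
    "\<And>L. L \<in> {marginal1 P, \<mu>} \<Longrightarrow> (\<integral>x. \<bar>\<theta> x - indicator B x\<bar> \<partial>L) < e / (2 * C)"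
    using continuous_approx_indicator[OF _ fin B, of "e / (2 * C)"] C(1) Suc.prems(3) by auto
  have \<theta>m[measurable]: "\<theta> \<in> borel_measurable borel" using \<theta>(1) by (rule borel_measurable_continuous_onI)
  have \<theta>_bd: "\<bar>\<theta> x - indicator B x\<bar> \<le> 1" for x using \<theta>(2)[of x] by (auto simp: indicator_def)
  define b' where "b' z = (1 - \<theta> (fst z)) * b1 z + \<theta> (fst z) * b (Suc n) z" for z
  define a' where "a' x = (1 - \<theta> x) * a1 x + \<theta> x * a (Suc n) x" for x
  have minor': "affine_minorant c b' a'"
    unfolding b'_def[abs_def] a'_def[abs_def] by (rule affine_minorant_blend[OF 1(1) minor \<theta>(1,2)])
  \<comment> \<open>The error of a blend: the error of the first component plus the error of the weight times the
    distance of the two components.\<close>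
  have key: "\<bar>((1 - t) * u + t * v) - (if i then v else w)\<bar> \<le> \<bar>u - w\<bar> + C * \<bar>t - of_bool i\<bar>"
    if "\<bar>u - v\<bar> \<le> C" "0 \<le> t \<and> t \<le> 1" for t u v w :: real and i
  proof (cases i)
    case True
    have "((1 - t) * u + t * v) - v = (u - v) * (1 - t)" by (simp add: algebra_simps)
    then have "\<bar>((1 - t) * u + t * v) - v\<bar> \<le> C * \<bar>t - 1\<bar>"
      using that by (auto simp: abs_mult intro!: mult_right_mono)
    then show ?thesis using True by simp
  next
    case False
    have "((1 - t) * u + t * v) - w = (u - w) - (u - v) * t" by (simp add: algebra_simps)
    then have "\<bar>((1 - t) * u + t * v) - w\<bar> \<le> \<bar>u - w\<bar> + \<bar>(u - v) * t\<bar>" by simp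
    also have "\<bar>(u - v) * t\<bar> \<le> C * \<bar>t\<bar>" using that by (auto simp: abs_mult intro!: mult_right_mono)
    finally show ?thesis using False by simp
  qed
  have pb: "\<bar>b' z - b (\<kappa> (fst z)) z\<bar> \<le> \<bar>b1 z - b (\<kappa>' (fst z)) z\<bar> + C * \<bar>\<theta> (fst z) - indicator B (fst z)\<bar>" for z
    using key[OF C(2)[of z] \<theta>(2)[of "fst z"], of "fst z \<in> B" "b (\<kappa>' (fst z)) z"]
    unfolding b'_def indicator_def \<kappa>_cases[of "fst z"] if_distrib[of "\<lambda>k. b k z"] .
  have pa: "\<bar>a' x - a (\<kappa> x) x\<bar> \<le> \<bar>a1 x - a (\<kappa>' x) x\<bar> + C * \<bar>\<theta> x - indicator B x\<bar>" for x
    using key[OF C(3)[of x] \<theta>(2)[of x], of "x \<in> B" "a (\<kappa>' x) x"]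
    unfolding a'_def indicator_def \<kappa>_cases[of x] if_distrib[of "\<lambda>k. a k x"] .
  obtain Db where Db: "\<forall>k\<le>Suc n. \<forall>z. \<bar>b k z\<bar> \<le> Db" using continuous_family_bounded[where f=b and n="Suc n", OF compact_XY cont(1)] by blast
  obtain Da where Da: "\<forall>k\<le>Suc n. \<forall>z. \<bar>a k z\<bar> \<le> Da" using continuous_family_bounded[where f=a and n="Suc n", OF compact_X cont(2)] by blast
  obtain Eb where Eb: "\<And>z. \<bar>b1 z\<bar> \<le> Eb" using continuous_on_compact_bounded[OF compact_XY cont1(1)] by blast
  obtain Ea where Ea: "\<And>z. \<bar>a1 z\<bar> \<le> Ea" using continuous_on_compact_bounded[OF compact_X cont1(2)] by blast
  have [measurable]: "b1 \<in> borel_measurable borel" "a1 \<in> borel_measurable borel"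
    using cont1 by (auto intro: borel_measurable_continuous_onI)
  note [measurable] = selection_measurable[OF cont \<kappa>'] selection_measurable[OF cont \<kappa>]
  have \<kappa>'n: "\<kappa>' x \<le> Suc n" for x by (simp add: \<kappa>'_def)
  have ib1: "integrable P (\<lambda>z. \<bar>b1 z - b (\<kappa>' (fst z)) z\<bar>)"
  proof (rule P.integrable_const_bound[where B="Eb + Db"])
    have "\<bar>b1 z - b (\<kappa>' (fst z)) z\<bar> \<le> Eb + Db" for z using Eb[of z] Db[rule_format, OF \<kappa>'n, of "fst z" z] by linarith
    then show "AE z in P. norm \<bar>b1 z - b (\<kappa>' (fst z)) z\<bar> \<le> Eb + Db" by simp
  qed measurable
  have ia1: "integrable \<mu> (\<lambda>x. \<bar>a1 x - a (\<kappa>' x) x\<bar>)"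
  proof (rule \<mu>.integrable_const_bound[where B="Ea + Da"])
    have "\<bar>a1 x - a (\<kappa>' x) x\<bar> \<le> Ea + Da" for x using Ea[of x] Da[rule_format, OF \<kappa>'n, of x x] by linarith
    then show "AE x in \<mu>. norm \<bar>a1 x - a (\<kappa>' x) x\<bar> \<le> Ea + Da" by simp
  qed measurable
  have i\<theta>P: "integrable P (\<lambda>z. \<bar>\<theta> (fst z) - indicator B (fst z)\<bar>)"
    using \<theta>_bd by (intro P.integrable_const_bound[where B=1]) auto
  have i\<theta>: "integrable \<mu> (\<lambda>x. \<bar>\<theta> x - indicator B x\<bar>)"
    using \<theta>_bd by (intro \<mu>.integrable_const_bound[where B=1]) auto
  have t1: "(\<integral>z. \<bar>\<theta> (fst z) - indicator B (fst z)\<bar> \<partial>P) < e / (2 * C)"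
  proof -
    have "fst \<in> P \<rightarrow>\<^sub>M borel" by measurable
    then have "(\<integral>x. \<bar>\<theta> x - indicator B x\<bar> \<partial>marginal1 P) = (\<integral>z. \<bar>\<theta> (fst z) - indicator B (fst z)\<bar> \<partial>P)"
      unfolding marginal1_def by (rule integral_distr) measurable
    then show ?thesis using \<theta>(3)[of "marginal1 P"] by simp
  qed
  have half: "C * u < e / 2" if "u < e / (2 * C)" for u
    using that C(1) by (simp add: field_simps)
  have "(\<integral>z. \<bar>b' z - b (\<kappa> (fst z)) z\<bar> \<partial>P) \<le> (\<integral>z. \<bar>b1 z - b (\<kappa>' (fst z)) z\<bar> + C * \<bar>\<theta> (fst z) - indicator B (fst z)\<bar> \<partial>P)"
    using ib1 i\<theta>P by (intro integral_mono'[OF _ pb order_trans[OF abs_ge_zero pb]]) simp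
  also have "\<dots> = (\<integral>z. \<bar>b1 z - b (\<kappa>' (fst z)) z\<bar> \<partial>P) + C * (\<integral>z. \<bar>\<theta> (fst z) - indicator B (fst z)\<bar> \<partial>P)"
    using ib1 i\<theta>P by simp
  also have "\<dots> < e" using 1(2) half[OF t1] by simp
  finally have rb: "(\<integral>z. \<bar>b' z - b (\<kappa> (fst z)) z\<bar> \<partial>P) < e" .
  have "(\<integral>x. \<bar>a' x - a (\<kappa> x) x\<bar> \<partial>\<mu>) \<le> (\<integral>x. \<bar>a1 x - a (\<kappa>' x) x\<bar> + C * \<bar>\<theta> x - indicator B x\<bar> \<partial>\<mu>)"
    using ia1 i\<theta> by (intro integral_mono'[OF _ pa order_trans[OF abs_ge_zero pa]]) simp
  also have "\<dots> = (\<integral>x. \<bar>a1 x - a (\<kappa>' x) x\<bar> \<partial>\<mu>) + C * (\<integral>x. \<bar>\<theta> x - indicator B x\<bar> \<partial>\<mu>)"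
    using ia1 i\<theta> by simp
  also have "\<dots> < e" using 1(3) half[OF \<theta>(3)[of \<mu>]] by simp
  finally show ?case using rb minor' by blast
qed

section \<open>Plans on which all affine minorants are bounded\<close>

text \<open>This transfers the bound \<open>J\<close> from continuous minorants to Borel selections by approximation in
  the mean; the other conclusions are the integrability facts that its uses require.\<close>
lemma selection_integral_le:
  fixes c :: "'a \<Rightarrow> 'b measure \<Rightarrow> real" and b :: "nat \<Rightarrow> 'a \<times> 'b \<Rightarrow> real" and a :: "nat \<Rightarrow> 'a \<Rightarrow> real"
  assumes minor: "\<And>k. affine_minorant c (b k) (a k)"
    and J: "\<And>b a. affine_minorant c b a \<Longrightarrow> integral\<^sup>L P b + integral\<^sup>L \<mu> a \<le> J"
    and \<kappa>: "\<kappa> \<in> borel \<rightarrow>\<^sub>M count_space UNIV" and n: "\<And>x. \<kappa> x \<le> n"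
  shows "\<exists>C. (\<forall>x. \<bar>cond_mean (b (\<kappa> x)) x\<bar> \<le> C) \<and> (\<forall>x. \<bar>a (\<kappa> x) x\<bar> \<le> C)"
    and "(\<lambda>x. cond_mean (b (\<kappa> x)) x) \<in> borel_measurable borel"
    and "(\<lambda>x. a (\<kappa> x) x) \<in> borel_measurable borel"
    and "(\<integral>x. cond_mean (b (\<kappa> x)) x \<partial>marginal1 P) + (\<integral>x. a (\<kappa> x) x \<partial>\<mu>) \<le> J"
proof -
  have cont: "continuous_on UNIV (b k)" "continuous_on UNIV (a k)" for k
    using minor by (auto simp: affine_minorant_def)
  obtain Db where Db: "\<forall>k\<le>n. \<forall>z. \<bar>b k z\<bar> \<le> Db"
    using continuous_family_bounded[where f=b and n=n, OF compact_XY cont(1)] by blast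
  obtain Da where Da: "\<forall>k\<le>n. \<forall>x. \<bar>a k x\<bar> \<le> Da"
    using continuous_family_bounded[where f=a and n=n, OF compact_X cont(2)] by blast
  define bs where "bs z = b (\<kappa> (fst z)) z" for z
  define as where "as x = a (\<kappa> x) x" for x
  have bs: "\<bar>bs z\<bar> \<le> Db" for z unfolding bs_def using Db n by blast
  have as: "\<bar>as x\<bar> \<le> Da" for x unfolding as_def using Da n by blast
  have m: "bs \<in> borel_measurable borel" "as \<in> borel_measurable borel"
    using selection_measurable[OF cont \<kappa>] by (simp_all add: bs_def[abs_def] as_def[abs_def])
  note [measurable] = m
  have cm: "cond_mean (b (\<kappa> x)) x = cond_mean bs x" for x by (simp add: cond_mean_def bs_def)
  show "(\<lambda>x. cond_mean (b (\<kappa> x)) x) \<in> borel_measurable borel"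
    unfolding cm using cond_mean(1)[OF m(1) bs] by simp
  show "(\<lambda>x. a (\<kappa> x) x) \<in> borel_measurable borel" using m(2) by (simp add: as_def[abs_def])
  have "\<bar>cond_mean (b (\<kappa> x)) x\<bar> \<le> max Db Da" "\<bar>a (\<kappa> x) x\<bar> \<le> max Db Da" for x
    unfolding cm using cond_mean(3)[OF m(1) bs, of x] as[of x] by (auto simp: as_def)
  then show "\<exists>C. (\<forall>x. \<bar>cond_mean (b (\<kappa> x)) x\<bar> \<le> C) \<and> (\<forall>x. \<bar>a (\<kappa> x) x\<bar> \<le> C)" by blast
  have i: "integrable P bs" "integrable \<mu> as"
    using bs as by (auto intro!: P.integrable_const_bound[where B=Db] \<mu>.integrable_const_bound[where B=Da])
  have "integral\<^sup>L P bs + integral\<^sup>L \<mu> as \<le> J"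
  proof (rule field_le_epsilon)
    fix e :: real assume "e > 0"
    then obtain b' a' where ba: "affine_minorant c b' a'"
      "(\<integral>z. \<bar>b' z - bs z\<bar> \<partial>P) < e / 2" "(\<integral>x. \<bar>a' x - as x\<bar> \<partial>\<mu>) < e / 2"
      using selection_approx[where b=b and a=a and c=c and \<kappa>=\<kappa> and n=n and e="e / 2", OF minor \<kappa> n] unfolding bs_def as_def by auto
    have cont': "continuous_on UNIV b'" "continuous_on UNIV a'" using ba(1) by (auto simp: affine_minorant_def)
    have [measurable]: "b' \<in> borel_measurable borel" "a' \<in> borel_measurable borel"
      using cont' by (auto intro: borel_measurable_continuous_onI)
    obtain B where B: "\<forall>z. \<bar>b' z\<bar> \<le> B" using continuous_on_compact_bounded[OF compact_XY cont'(1)] by blast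
    obtain A where A: "\<forall>x. \<bar>a' x\<bar> \<le> A" using continuous_on_compact_bounded[OF compact_X cont'(2)] by blast
    have i': "integrable P b'" "integrable \<mu> a'"
      using A B by (auto intro!: P.integrable_const_bound[where B=B] \<mu>.integrable_const_bound[where B=A])
    have "\<bar>integral\<^sup>L P b' - integral\<^sup>L P bs\<bar> \<le> (\<integral>z. \<bar>b' z - bs z\<bar> \<partial>P)"
      using i i' integral_abs_bound[of P "\<lambda>z. b' z - bs z"] by simp
    moreover have "\<bar>integral\<^sup>L \<mu> a' - integral\<^sup>L \<mu> as\<bar> \<le> (\<integral>x. \<bar>a' x - as x\<bar> \<partial>\<mu>)"
      using i i' integral_abs_bound[of \<mu> "\<lambda>x. a' x - as x"] by simp
    ultimately show "integral\<^sup>L P bs + integral\<^sup>L \<mu> as \<le> J + e"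
      using J[OF ba(1)] ba(2,3) by linarith
  qed
  then show "(\<integral>x. cond_mean (b (\<kappa> x)) x \<partial>marginal1 P) + (\<integral>x. a (\<kappa> x) x \<partial>\<mu>) \<le> J"
    unfolding cm cond_mean(2)[OF m(1) bs] as_def .
qed

text \<open>If all the conditional means at \<open>x\<close> were at most \<open>R\<close>, then
  \<open>c x (l K x) \<le> l R + sup\<^sub>k a\<^sub>k x = l R + c x 0\<close>, which grows only linearly in \<open>l\<close>. That the last
  supremum is finite is where the finiteness of the cost at the zero measure enters.\<close>
lemma cond_means_unbounded:
  fixes c :: "'a \<Rightarrow> 'b measure \<Rightarrow> real"
  assumes c: "\<And>x m. m \<in> borel_finite_measures \<Longrightarrow>
      ereal (c x m) = (SUP k. ereal ((\<integral>y. b k (x, y) \<partial>m) + a k x))"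
    and cont: "\<And>k. continuous_on UNIV (b k)" and sl: "superlinear_cost c"
  shows "\<exists>k::nat. R < cond_mean (b k) x"
proof (rule ccontr)
  assume "\<not> ?thesis"
  then have R: "cond_mean (b k) x \<le> R" for k by (simp add: not_less)
  define c0 where "c0 = c x (null_measure borel)"
  have null: "null_measure borel \<in> (borel_finite_measures :: 'b measure set)"
    by (auto simp: borel_finite_measures_def intro!: finite_measureI)
  have "ereal (a k x) \<le> ereal c0" for k
  proof -
    have "ereal ((\<integral>y. b k (x, y) \<partial>null_measure borel) + a k x) \<le> ereal c0"
      unfolding c0_def c[OF null] by (rule SUP_upper) simp
    then show ?thesis by simp
  qed
  then have a: "a k x \<le> c0" for k by simp
  have le: "c x (scale_measure (ennreal l) (K x)) / l \<le> R + \<bar>c0\<bar>" if l: "1 \<le> l" for l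
  proof -
    have "ereal (c x (scale_measure (ennreal l) (K x))) \<le> ereal (l * R + c0)"
      unfolding c[OF scaled_kernel(1)[OF order_trans[OF zero_le_one l]]]
    proof (rule SUP_least)
      fix k
      have *: "l * cond_mean (b k) x \<le> l * R" using R l by (intro mult_left_mono) auto
      then show "ereal ((\<integral>y. b k (x, y) \<partial>scale_measure (ennreal l) (K x)) + a k x) \<le> ereal (l * R + c0)"
        using add_mono[OF * a[of k]] l by (simp add: scaled_kernel(2)[OF _ cont])
    qed
    then have "c x (scale_measure (ennreal l) (K x)) / l \<le> (l * R + c0) / l"
      using l by (intro divide_right_mono) auto
    also have "\<dots> = R + c0 / l" using l by (simp add: field_simps)
    also have "c0 / l \<le> \<bar>c0\<bar> / 1" using l by (intro frac_le) auto
    finally show ?thesis by simp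
  qed
  have Kx: "K x \<in> borel_finite_measures - {null_measure borel}"
  proof -
    note Kx = is_disintegration_prob[OF K, of x]
    interpret Kx: prob_space "K x" by (rule Kx)
    have "emeasure (K x) UNIV = 1" using Kx.emeasure_space_1 by (simp add: Kx)
    then have "K x \<noteq> null_measure borel" by auto
    then show ?thesis using Kx.finite_measure_axioms Kx by (simp add: borel_finite_measures_def)
  qed
  then have "filterlim (\<lambda>l::real. c x (scale_measure (ennreal l) (K x)) / l) at_top at_top"
    using sl by (simp add: superlinear_cost_def)
  then have "\<forall>\<^sub>F l in at_top. R + \<bar>c0\<bar> < c x (scale_measure (ennreal l) (K x)) / l"
    by (simp add: filterlim_at_top_dense)
  then have "\<forall>\<^sub>F l::real in at_top. False"
    using eventually_ge_at_top[of 1] by eventually_elim (use le in force)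
  then show False by simp
qed

text \<open>On a \<open>\<mu>\<close>-null set the index is chosen to maximise the conditional mean among the first \<open>n\<close>, and
  elsewhere it is 0. The part integrated against \<open>\<mu>\<close> does not notice the choice, so the integrals of
  \<open>v n\<close> against the first marginal stay bounded, while \<open>v n\<close> increases to infinity on the null set.\<close>
lemma absolutely_continuous_marginal:
  fixes c :: "'a \<Rightarrow> 'b measure \<Rightarrow> real" and b :: "nat \<Rightarrow> 'a \<times> 'b \<Rightarrow> real" and a :: "nat \<Rightarrow> 'a \<Rightarrow> real"
  assumes minor: "\<And>k. affine_minorant c (b k) (a k)"
    and J: "\<And>b a. affine_minorant c b a \<Longrightarrow> integral\<^sup>L P b + integral\<^sup>L \<mu> a \<le> J"
    and unbdd: "\<And>x R. \<exists>k. R < cond_mean (b k) x"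
  shows "absolutely_continuous \<mu> (marginal1 P)"
  unfolding absolutely_continuous_def
proof
  fix N assume "N \<in> null_sets \<mu>"
  then have [measurable]: "N \<in> sets borel" and N0: "AE x in \<mu>. x \<notin> N"
    by (auto simp: null_sets_def intro!: AE_not_in)
  define \<beta> where "\<beta> k x = cond_mean (b k) x" for k x
  define \<kappa> where "\<kappa> n x = (if x \<in> N then argmax_upto \<beta> n x else 0)" for n x
  have \<kappa>_le: "\<kappa> n x \<le> n" for n x by (simp add: \<kappa>_def argmax_upto(1))
  note sel_const = selection_integral_le[where b=b and a=a and \<kappa>="\<lambda>_. k" and n=k for k, OF minor J, simplified]
  have \<beta>_meas[measurable]: "\<beta> k \<in> borel_measurable borel" for k
    unfolding \<beta>_def[abs_def] by (rule sel_const(2))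
  have \<kappa>_meas[measurable]: "\<kappa> n \<in> borel \<rightarrow>\<^sub>M count_space UNIV" for n unfolding \<kappa>_def by measurable
  note sel = selection_integral_le[where b=b and a=a and \<kappa>="\<kappa> n" and n=n for n, OF minor J \<kappa>_meas \<kappa>_le]
  define v where "v n x = \<beta> (\<kappa> n x) x - \<beta> 0 x" for n x
  have v_out: "v n x = 0" if "x \<notin> N" for n x using that by (simp add: v_def \<kappa>_def)
  have v_ge: "\<beta> k x - \<beta> 0 x \<le> v n x" if "x \<in> N" "k \<le> n" for k n x
    using that argmax_upto(2)[where u=\<beta> and j=k and n=n and x=x] by (simp add: v_def \<kappa>_def)
  have v_nn: "0 \<le> v n x" for n x using v_out[of x n] v_ge[of x 0 n] by (cases "x \<in> N") auto
  have v_mono: "v n x \<le> v (Suc n) x" for n x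
  proof (cases "x \<in> N")
    case True
    have "\<beta> (\<kappa> n x) x - \<beta> 0 x \<le> v (Suc n) x" using True \<kappa>_le[of n x] by (intro v_ge) auto
    then show ?thesis by (simp add: v_def)
  qed (simp add: v_out)
  have v_meas[measurable]: "v n \<in> borel_measurable borel" for n
    unfolding v_def[abs_def] using sel(2)[of n] sel_const(2)[of 0] by (intro borel_measurable_diff) (simp_all add: \<beta>_def)
  have i\<beta>: "integrable (marginal1 P) (\<lambda>x. \<beta> (\<kappa> n x) x)" for n
  proof -
    obtain C where "\<forall>x. \<bar>cond_mean (b (\<kappa> n x)) x\<bar> \<le> C" using sel(1)[of n] by blast
    then show ?thesis using sel(2)[of n]
      by (intro P1.integrable_const_bound[where B=C]) (auto simp: \<beta>_def measurable_cong_sets[OF sets_marginal1 refl])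
  qed
  have i\<beta>0: "integrable (marginal1 P) (\<beta> 0)" using i\<beta>[of 0] \<kappa>_le[of 0] by simp
  define D where "D = J - (\<integral>x. a 0 x \<partial>\<mu>) - integral\<^sup>L (marginal1 P) (\<beta> 0)"
  have vD: "integral\<^sup>L (marginal1 P) (v n) \<le> D" for n
  proof -
    have "(\<integral>x. a (\<kappa> n x) x \<partial>\<mu>) = (\<integral>x. a 0 x \<partial>\<mu>)"
      using N0 sel(3)[of n] sel_const(3)[of 0]
      by (intro integral_cong_AE) (auto simp: \<kappa>_def measurable_cong_sets[OF sets_\<mu> refl])
    moreover have "integral\<^sup>L (marginal1 P) (v n) = (\<integral>x. \<beta> (\<kappa> n x) x \<partial>marginal1 P) - integral\<^sup>L (marginal1 P) (\<beta> 0)"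
      unfolding v_def[abs_def] using i\<beta>[of n] i\<beta>0 by (rule Bochner_Integration.integral_diff)
    ultimately show ?thesis
      using sel(4)[of n, folded \<beta>_def] unfolding D_def by linarith
  qed
  have iv: "integrable (marginal1 P) (v n)" for n
    unfolding v_def[abs_def] using i\<beta> i\<beta>0 by (rule Bochner_Integration.integrable_diff)
  have top: "(SUP n. ennreal (v n x)) = top" if x: "x \<in> N" for x
  proof (rule ennreal_SUP_eq_top)
    fix m :: nat
    obtain k where "real m + \<beta> 0 x < \<beta> k x" using unbdd[of "real m + \<beta> 0 x" x] by (auto simp: \<beta>_def)
    then have "real m \<le> v k x" using v_ge[OF x, of k k] by simp
    then show "\<exists>i\<in>UNIV. of_nat m \<le> ennreal (v i x)"
      by (intro bexI[of _ k]) (auto simp: ennreal_of_nat_eq_real_of_nat intro: ennreal_leI)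
  qed
  have "top * indicator N x \<le> (SUP n. ennreal (v n x))" for x
  proof (cases "x \<in> N")
    case True
    show ?thesis unfolding top[OF True] by simp
  qed simp
  then have "(\<integral>\<^sup>+x. top * indicator N x \<partial>marginal1 P) \<le> (\<integral>\<^sup>+x. (SUP n. ennreal (v n x)) \<partial>marginal1 P)"
    by (rule nn_integral_mono)
  also have "\<dots> = (SUP n. \<integral>\<^sup>+x. ennreal (v n x) \<partial>marginal1 P)"
    using v_mono by (intro nn_integral_monotone_convergence_SUP)
      (auto simp: incseq_Suc_iff le_fun_def measurable_cong_sets[OF sets_marginal1 refl] intro: ennreal_leI)
  also have "\<dots> \<le> ennreal D"
  proof (rule SUP_least)
    fix n
    have "(\<integral>\<^sup>+x. ennreal (v n x) \<partial>marginal1 P) = ennreal (integral\<^sup>L (marginal1 P) (v n))"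
      using iv v_nn by (intro nn_integral_eq_integral) auto
    then show "(\<integral>\<^sup>+x. ennreal (v n x) \<partial>marginal1 P) \<le> ennreal D" using vD[of n] by (simp add: ennreal_leI)
  qed
  finally have "top * emeasure (marginal1 P) N \<le> ennreal D"
    by (subst (asm) nn_integral_cmult_indicator) auto
  then have "emeasure (marginal1 P) N = 0"
    by (cases "emeasure (marginal1 P) N = 0") (auto simp: ennreal_top_mult top_unique)
  then show "N \<in> null_sets (marginal1 P)" by (simp add: null_sets_def)
qed

text \<open>The best of the first \<open>n\<close> affine functions at the actual argument of the cost increases to the
  cost, and its integral is bounded by \<open>J\<close> as an integral of a Borel selection.\<close>
lemma plan_cost_le:
  fixes c :: "'a \<Rightarrow> 'b measure \<Rightarrow> real" and b :: "nat \<Rightarrow> 'a \<times> 'b \<Rightarrow> real" and a :: "nat \<Rightarrow> 'a \<Rightarrow> real"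
  assumes ac: "absolutely_continuous \<mu> (marginal1 P)"
    and c: "\<And>x m. m \<in> borel_finite_measures \<Longrightarrow>
      ereal (c x m) = (SUP k. ereal ((\<integral>y. b k (x, y) \<partial>m) + a k x))"
    and minor: "\<And>k. affine_minorant c (b k) (a k)"
    and J: "\<And>b a. affine_minorant c b a \<Longrightarrow> integral\<^sup>L P b + integral\<^sup>L \<mu> a \<le> J"
  shows "plan_cost c \<mu> P \<le> ereal J"
proof -
  have cont: "continuous_on UNIV (b k)" for k using minor by (auto simp: affine_minorant_def)
  define u where "u k x = dens x * cond_mean (b k) x + a k x" for k x
  define \<kappa> where "\<kappa> n = argmax_upto u n" for n
  note sel_const = selection_integral_le[where b=b and a=a and \<kappa>="\<lambda>_. k" and n=k for k, OF minor J, simplified]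
  have [measurable]: "cond_mean (b k) \<in> borel_measurable borel" "a k \<in> borel_measurable borel" for k
    using sel_const(2,3) by auto
  have [measurable]: "u k \<in> borel_measurable borel" for k unfolding u_def[abs_def] by measurable
  have \<kappa>_meas: "\<kappa> n \<in> borel \<rightarrow>\<^sub>M count_space UNIV" for n unfolding \<kappa>_def by measurable
  have \<kappa>_le: "\<kappa> n x \<le> n" for n x by (simp add: \<kappa>_def argmax_upto(1))
  note sel = selection_integral_le[where b=b and a=a and \<kappa>="\<kappa> n" and n=n for n, OF minor J \<kappa>_meas \<kappa>_le]
  define w where "w n x = u (\<kappa> n x) x" for n x
  have w_ge: "u k x \<le> w n x" if "k \<le> n" for k n x
    using argmax_upto(2)[where u=u and x=x, OF that] by (simp add: w_def \<kappa>_def)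
  have w_mono: "w n x \<le> w (Suc n) x" for n x
    using w_ge[of "\<kappa> n x" "Suc n" x] \<kappa>_le[of n x] by (simp add: w_def)
  have w_int: "integrable \<mu> (w n) \<and> integral\<^sup>L \<mu> (w n) \<le> J" for n
  proof -
    obtain C where C: "\<forall>x. \<bar>cond_mean (b (\<kappa> n x)) x\<bar> \<le> C" "\<forall>x. \<bar>a (\<kappa> n x) x\<bar> \<le> C"
      using sel(1)[of n] by blast
    note d = dens_integral[OF ac sel(2)[of n] C(1)[rule_format]]
    have ia: "integrable \<mu> (\<lambda>x. a (\<kappa> n x) x)"
      using C(2) sel(3)[of n] by (intro \<mu>.integrable_const_bound[where B=C]) (auto simp: measurable_cong_sets[OF sets_\<mu> refl])
    show ?thesis using d ia sel(4)[of n] by (simp add: w_def[abs_def] u_def)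
  qed
  have "AE x in \<mu>. (\<lambda>n. w n x) \<longlonglongrightarrow> c x (scale_measure (RN_deriv \<mu> (marginal1 P) x) (K x))"
    using AE_dens[OF ac]
  proof eventually_elim
    case (elim x)
    define l where "l = c x (scale_measure (ennreal (dens x)) (K x))"
    have l: "ereal l = (SUP k. ereal (u k x))"
      unfolding l_def c[OF scaled_kernel(1)[OF dens_nonneg]] u_def scaled_kernel(2)[OF dens_nonneg cont] ..
    have "(\<lambda>n. w n x) \<longlonglongrightarrow> l"
    proof (rule increasing_LIMSEQ)
      show "w n x \<le> w (Suc n) x" for n by (rule w_mono)
      have "ereal (w n x) \<le> ereal l" for n unfolding l w_def by (rule SUP_upper) simp
      then show "w n x \<le> l" for n by simp
      fix e :: real assume "e > 0"
      then have "ereal (l - e) < (SUP k. ereal (u k x))" unfolding l[symmetric] by simp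
      then obtain k where "l - e < u k x" by (auto simp: less_SUP_iff)
      then show "\<exists>n. l \<le> w n x + e" using w_ge[of k k x] by (intro exI[of _ k]) simp
    qed
    then show ?case unfolding elim l_def .
  qed
  then show ?thesis
    unfolding plan_cost_def using w_int w_mono by (intro ext_integral_le_of_incseq[of \<mu> w]) (auto simp: incseq_Suc_iff)
qed

end

section \<open>Weak solutions are strong\<close>
theorem theorem2p2:
  fixes c :: "'a::metric_space \<Rightarrow> 'b::metric_space measure \<Rightarrow> real"
    and \<mu> :: "'a measure" and \<nu> :: "'b measure" and \<pi> :: "('a \<times> 'b) measure"
  assumes "compact (UNIV :: 'a set)" and "compact (UNIV :: 'b set)"
    and "affine_sup_cost c"
    and "superlinear_cost c"
    and "\<mu> \<in> borel_probs" and "\<nu> \<in> borel_probs"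
    and "transport_value c \<mu> \<nu> < \<infinity>"
    and "weak_solution c \<mu> \<nu> \<pi>"
  shows "strong_solution c \<mu> \<nu> \<pi>"
proof -
  obtain P where \<pi>: "\<pi> \<in> borel_probs" and P: "\<And>n. P n \<in> transport_plans \<mu> \<nu>"
    and conv: "weakly_converges P \<pi>"
    and cost: "(\<lambda>n. plan_cost c \<mu> (P n)) \<longlonglongrightarrow> transport_value c \<mu> \<nu>"
    using assms(8) by (auto simp: weak_solution_def)
  obtain a b where cont: "\<And>k. continuous_on UNIV (a k)" "\<And>k. continuous_on UNIV (b k)"
    and c: "\<And>x m. m \<in> borel_finite_measures \<Longrightarrow>
      ereal (c x m) = (SUP k::nat. ereal ((\<integral>y. b k (x, y) \<partial>m) + a k x))"
    using assms(3) unfolding affine_sup_cost_def by blast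
  interpret lim: compact_plan \<mu> \<pi>
    using assms \<pi> by unfold_locales
  have minor: "affine_minorant c (b k) (a k)" for k
    unfolding affine_minorant_def
  proof (intro conjI cont allI ballI)
    fix x and m :: "'b measure" assume m: "m \<in> borel_finite_measures"
    have "ereal ((\<integral>y. b k (x, y) \<partial>m) + a k x) \<le> ereal (c x m)"
      unfolding c[OF m] by (rule SUP_upper) simp
    then show "(\<integral>y. b k (x, y) \<partial>m) + a k x \<le> c x m" by simp
  qed
  have weak_lim: "(\<lambda>n. integral\<^sup>L (P n) f) \<longlonglongrightarrow> integral\<^sup>L \<pi> f" if f: "continuous_on UNIV f" for f :: "'a \<times> 'b \<Rightarrow> real"
    using conv f compact_imp_bounded[OF compact_continuous_image[OF f lim.compact_XY]]
    by (simp add: weakly_converges_def)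
  have value_ge: "ereal (integral\<^sup>L \<pi> b' + integral\<^sup>L \<mu> a') \<le> transport_value c \<mu> \<nu>"
    if ba: "affine_minorant c b' a'" for b' a'
  proof (rule LIMSEQ_le[OF _ cost])
    have "continuous_on UNIV b'" using ba by (simp add: affine_minorant_def)
    then show "(\<lambda>n. ereal (integral\<^sup>L (P n) b' + integral\<^sup>L \<mu> a')) \<longlonglongrightarrow> ereal (integral\<^sup>L \<pi> b' + integral\<^sup>L \<mu> a')"
      by (intro tendsto_intros weak_lim)
    have "ereal (integral\<^sup>L (P n) b' + integral\<^sup>L \<mu> a') \<le> plan_cost c \<mu> (P n)" for n
    proof -
      have "P n \<in> borel_probs" and ac: "absolutely_continuous \<mu> (marginal1 (P n))"
        using P[of n] by (auto simp: transport_plans_def)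
      then interpret Pn: compact_plan \<mu> "P n" using assms by unfold_locales
      show ?thesis by (rule Pn.affine_minorant_le_plan_cost[OF ac ba])
    qed
    then show "\<exists>N. \<forall>n\<ge>N. ereal (integral\<^sup>L (P n) b' + integral\<^sup>L \<mu> a') \<le> plan_cost c \<mu> (P n)" by blast
  qed
  \<comment> \<open>Any single minorant shows that the transport value is not \<open>-\<infinity>\<close>.\<close>
  obtain J where J: "transport_value c \<mu> \<nu> = ereal J"
    using value_ge[OF minor[of 0]] assms(7) by (cases "transport_value c \<mu> \<nu>") auto
  have J_ge: "integral\<^sup>L \<pi> b' + integral\<^sup>L \<mu> a' \<le> J" if "affine_minorant c b' a'" for b' a'
    using value_ge[OF that] by (simp add: J)
  have ac: "absolutely_continuous \<mu> (marginal1 \<pi>)"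
    by (rule lim.absolutely_continuous_marginal[OF minor J_ge lim.cond_means_unbounded[OF c cont(2) assms(4)]])
  have "marginal2 \<pi> = \<nu>"
  proof (rule measure_eqI_continuous_integrals)
    have snd: "snd \<in> Q \<rightarrow>\<^sub>M borel" if "sets Q = sets borel" for Q :: "('a \<times> 'b) measure"
      unfolding measurable_cong_sets[OF that refl]
      by (intro borel_measurable_continuous_onI continuous_intros)
    have "prob_space (marginal2 \<pi>)"
      unfolding marginal2_def by (rule lim.P.prob_space_distr[OF snd]) simp
    then show "marginal2 \<pi> \<in> borel_finite_measures"
      by (simp add: borel_finite_measures_def marginal2_def prob_space_def)
    show "\<nu> \<in> borel_finite_measures"
      using assms(6) by (simp add: borel_finite_measures_def borel_probs_def prob_space_def)
    fix f :: "'b \<Rightarrow> real" assume f: "continuous_on UNIV f"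
    have fm: "f \<in> borel_measurable borel" using f by (rule borel_measurable_continuous_onI)
    have fsnd: "continuous_on UNIV (\<lambda>z. f (snd z))"
      by (intro continuous_on_compose2[OF f] continuous_intros) auto
    have eq: "integral\<^sup>L (marginal2 Q) f = (\<integral>z. f (snd z) \<partial>Q)" if "sets Q = sets borel" for Q :: "('a \<times> 'b) measure"
      unfolding marginal2_def by (rule integral_distr[OF snd[OF that] fm])
    have "(\<integral>z. f (snd z) \<partial>P n) = integral\<^sup>L \<nu> f" for n
      using P[of n] eq[of "P n"] by (auto simp: transport_plans_def borel_probs_def)
    then have "(\<lambda>n. integral\<^sup>L \<nu> f) \<longlonglongrightarrow> (\<integral>z. f (snd z) \<partial>\<pi>)"
      using weak_lim[OF fsnd] by simp
    then show "integral\<^sup>L (marginal2 \<pi>) f = integral\<^sup>L \<nu> f"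
      using LIMSEQ_unique[OF tendsto_const] eq[OF lim.sets_P] by metis
  qed
  then have plan: "\<pi> \<in> transport_plans \<mu> \<nu>" using \<pi> ac by (simp add: transport_plans_def)
  have "plan_cost c \<mu> \<pi> \<le> transport_value c \<mu> \<nu>"
    unfolding J by (rule lim.plan_cost_le[OF ac c minor J_ge])
  moreover have "transport_value c \<mu> \<nu> \<le> plan_cost c \<mu> \<pi>"
    unfolding transport_value_def using plan by (rule INF_lower)
  ultimately show ?thesis using plan by (simp add: strong_solution_def)
qed

end
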